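(* Let $W$ be a Brownian motion, let $\alpha(t),\beta(t),\sigma(t)$ be deterministic integrable functions, and let $(\lambda_t)_{t\ge s}$ solve $$d\lambda_t=(\alpha(t)-\beta(t)\lambda_t)\,dt+\sigma(t)\,dW_t,\qquad t\ge s,$$ with initial condition $\lambda_s$ known at time $s$, where the coefficients are assumed to be such that existence and uniqueness conditions for the solution are met. Let $\Lambda_{s,t}:=\int_s^t\lambda_u\,du$. Then for every $t\ge s$ the Laplace transform of $\Lambda_{s,t}$, conditional upon $\lambda_s$, is $$\phi_{\Lambda_{s,t}}(x)=\exp\left\{-M(s,t)\,x+\frac{x^2V(s,t)}{2}\right\},$$ where $$M(s,t):=(t-s)\lambda_s+\int_s^t(t-u)\Bigl(\alpha(u)-\beta(u)G(s,u)\bigl(\lambda_s+I(s,u)\bigr)\Bigr)du,\qquad V(s,t):=\int_s^tK^2(u,t)\,du,$$ $$G(s,t):=e^{-\int_s^t\beta(u)du},\qquad I(s,t):=\int_s^t\alpha(u)G(u,s)\,du,\qquad K(s,t):=\int_s^t\sigma(s)G(s,u)\,du .$$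
   Context: All processes live on a filtered probability space $(\Omega,\mathbb{F},\mathcal{F}_t,\mathbb{Q})$, with $W$ a Brownian motion for the filtration and $\lambda_s$ being $\mathcal{F}_s$-measurable. The (conditional) Laplace transform is $\phi_{\Lambda_{s,t}}(x):=\mathbb{E}[e^{-x\Lambda_{s,t}}\mid\lambda_s]$. For $u\ge s$, $G(u,s)=e^{-\int_u^s\beta(v)dv}=e^{\int_s^u\beta(v)dv}=1/G(s,u)$. The assumption that existence and uniqueness conditions are met includes that the stochastic integrals with respect to $W$ are well defined. *)

theory Defs
  imports "HOL-Probability.Probability"
begin

section \<open>Brownian motion on a filtered probability space\<close>

text \<open>Time is \<open>[0, \<infinity>)\<close>; the \<open>\<sigma>\<close>-algebras \<open>F t\<close> with \<open>t < 0\<close>, which exist only because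
  the library's \<^locale>\<open>filtration\<close> is indexed by a whole type, play no role (a filtration on
  \<open>[0, \<infinity>)\<close> may be extended by \<open>F 0\<close>).\<close>

locale filtered_prob_space = prob_space M + filtration "space M" F
  for M :: "'a measure" and F :: "real \<Rightarrow> 'a measure" +
  assumes sets_F_subset: "\<And>t. sets (F t) \<subseteq> sets M"

locale brownian_motion = filtered_prob_space M F
  for M :: "'a measure" and F :: "real \<Rightarrow> 'a measure" +
  fixes W :: "real \<Rightarrow> 'a \<Rightarrow> real"
  assumes adapted: "\<And>t. 0 \<le> t \<Longrightarrow> W t \<in> borel_measurable (F t)"
    and start: "AE \<omega> in M. W 0 \<omega> = 0"
    and increment_distributed: "\<And>u v. 0 \<le> u \<Longrightarrow> u < v \<Longrightarrow>
      distributed M lborel (\<lambda>\<omega>. W v \<omega> - W u \<omega>) (normal_density 0 (sqrt (v - u)))"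
    and increment_indep: "\<And>u v. 0 \<le> u \<Longrightarrow> u < v \<Longrightarrow>
      indep_set (sets (F u)) {(\<lambda>\<omega>. W v \<omega> - W u \<omega>) -` A \<inter> space M | A. A \<in> sets borel}"
    and continuous_paths: "AE \<omega> in M. continuous_on {0..} (\<lambda>t. W t \<omega>)"

section \<open>The Ito integral\<close>

text \<open>A simple integrand on \<open>[s, t]\<close> is given by a partition \<open>s = p 0 \<le> \<dots> \<le> p n = t\<close> and
  bounded, \<open>F (p i)\<close>-measurable values \<open>\<xi> i\<close> on \<open>(p i, p (i + 1)]\<close>.\<close>

definition simple_integrand ::
  "'a measure \<Rightarrow> (real \<Rightarrow> 'a measure) \<Rightarrow> real \<Rightarrow> real \<Rightarrow> nat \<Rightarrow> (nat \<Rightarrow> real) \<Rightarrow> (nat \<Rightarrow> 'a \<Rightarrow> real) \<Rightarrow> bool"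
where
  "simple_integrand M F s t n p \<xi> \<longleftrightarrow>
     p 0 = s \<and> p n = t \<and> (\<forall>i<n. p i \<le> p (Suc i)) \<and>
     (\<forall>i<n. \<xi> i \<in> borel_measurable (F (p i))) \<and>
     (\<exists>C. \<forall>i<n. \<forall>\<omega>\<in>space M. \<bar>\<xi> i \<omega>\<bar> \<le> C)"

definition simple_process ::
  "nat \<Rightarrow> (nat \<Rightarrow> real) \<Rightarrow> (nat \<Rightarrow> 'a \<Rightarrow> real) \<Rightarrow> real \<Rightarrow> 'a \<Rightarrow> real"
where
  "simple_process n p \<xi> u \<omega> = (\<Sum>i<n. \<xi> i \<omega> * indicator {p i<..p (Suc i)} u)"

definition simple_ito_integral ::
  "(real \<Rightarrow> 'a \<Rightarrow> real) \<Rightarrow> nat \<Rightarrow> (nat \<Rightarrow> real) \<Rightarrow> (nat \<Rightarrow> 'a \<Rightarrow> real) \<Rightarrow> 'a \<Rightarrow> real"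
where
  "simple_ito_integral W n p \<xi> \<omega> = (\<Sum>i<n. \<xi> i \<omega> * (W (p (Suc i)) \<omega> - W (p i) \<omega>))"

text \<open>\<open>X\<close> is a version of \<open>\<integral>\<^sub>s\<^sup>t H dW\<close>: the integrand \<open>H\<close> is measurable, adapted and in
  \<open>L\<^sup>2([s, t] \<times> \<Omega>)\<close>, and \<open>X\<close> is the \<open>L\<^sup>2\<close>-limit of the integrals of simple integrands
  that converge to \<open>H\<close> in \<open>L\<^sup>2([s, t] \<times> \<Omega>)\<close>. In particular \<open>H\<close> has such an integral only if
  it is square integrable; for a deterministic integrand this is the exact condition for
  the integral to be defined.\<close>

definition has_ito_integral ::
  "'a measure \<Rightarrow> (real \<Rightarrow> 'a measure) \<Rightarrow> (real \<Rightarrow> 'a \<Rightarrow> real) \<Rightarrow>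
   (real \<Rightarrow> 'a \<Rightarrow> real) \<Rightarrow> real \<Rightarrow> real \<Rightarrow> ('a \<Rightarrow> real) \<Rightarrow> bool"
where
  "has_ito_integral M F W H s t X \<longleftrightarrow>
     (\<lambda>(u, \<omega>). H u \<omega>) \<in> borel_measurable (restrict_space borel {s..t} \<Otimes>\<^sub>M M) \<and>
     (\<forall>u\<in>{s..t}. H u \<in> borel_measurable (F u)) \<and>
     (\<integral>\<^sup>+\<omega>. (\<integral>\<^sup>+u\<in>{s..t}. ennreal ((H u \<omega>)\<^sup>2) \<partial>lborel) \<partial>M) < \<infinity> \<and>
     X \<in> borel_measurable M \<and>
     (\<exists>n p \<xi>.
        (\<forall>k. simple_integrand M F s t (n k) (p k) (\<xi> k)) \<and>
        (\<lambda>k. \<integral>\<^sup>+\<omega>. (\<integral>\<^sup>+u\<in>{s..t}.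
            ennreal ((simple_process (n k) (p k) (\<xi> k) u \<omega> - H u \<omega>)\<^sup>2) \<partial>lborel) \<partial>M)
          \<longlonglongrightarrow> 0 \<and>
        (\<lambda>k. \<integral>\<^sup>+\<omega>. ennreal ((simple_ito_integral W (n k) (p k) (\<xi> k) \<omega> - X \<omega>)\<^sup>2) \<partial>M)
          \<longlonglongrightarrow> 0)"

section \<open>Stochastic differential equations with additive noise\<close>

text \<open>\<open>Y\<close> solves \<open>dY\<^sub>t = b(t, Y\<^sub>t) dt + \<sigma>(t) dW\<^sub>t\<close> for \<open>t \<ge> s\<close>. No condition is put on the
  initial value \<open>Y\<^sub>s\<close> beyond its being \<open>F s\<close>-measurable. Paths are only required to be
  continuous almost surely; since \<open>M\<close> need not be complete, joint measurability is required
  separately, so that time integrals of \<open>Y\<close> are random variables (it is automatic if all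
  paths are continuous).\<close>

definition sde_solution ::
  "'a measure \<Rightarrow> (real \<Rightarrow> 'a measure) \<Rightarrow> (real \<Rightarrow> 'a \<Rightarrow> real) \<Rightarrow>
   (real \<Rightarrow> real \<Rightarrow> real) \<Rightarrow> (real \<Rightarrow> real) \<Rightarrow> real \<Rightarrow> (real \<Rightarrow> 'a \<Rightarrow> real) \<Rightarrow> bool"
where
  "sde_solution M F W b \<sigma> s Y \<longleftrightarrow>
     (\<forall>t\<ge>s. Y t \<in> borel_measurable (F t)) \<and>
     (\<lambda>(u, \<omega>). Y u \<omega>) \<in> borel_measurable (restrict_space borel {s..} \<Otimes>\<^sub>M M) \<and>
     (AE \<omega> in M. continuous_on {s..} (\<lambda>t. Y t \<omega>)) \<and>
     (\<forall>t\<ge>s. AE \<omega> in M. set_integrable lborel {s..t} (\<lambda>u. b u (Y u \<omega>))) \<and>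
     (\<forall>t\<ge>s. \<exists>N. has_ito_integral M F W (\<lambda>u \<omega>. \<sigma> u) s t N \<and>
        (AE \<omega> in M. Y t \<omega> = Y s \<omega> + (LBINT u=s..t. b u (Y u \<omega>)) + N \<omega>))"

section \<open>Conditional Laplace transform\<close>

text \<open>\<open>E[exp (- x X) | Z]\<close> is the conditional expectation of a nonnegative random variable,
  which need not be integrable; hence it is taken with values in \<open>[0, \<infinity>]\<close>.\<close>

definition cond_laplace ::
  "'a measure \<Rightarrow> ('a \<Rightarrow> real) \<Rightarrow> ('a \<Rightarrow> real) \<Rightarrow> real \<Rightarrow> 'a \<Rightarrow> ennreal"
where
  "cond_laplace M X Z x =
     nn_cond_exp M (vimage_algebra (space M) Z borel) (\<lambda>\<omega>. ennreal (exp (- x * X \<omega>)))"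

section \<open>The coefficient functions\<close>

text \<open>\<open>LBINT v=a..b\<close> is an oriented integral, so that \<open>ou_G \<beta> u s = 1 / ou_G \<beta> s u\<close>.\<close>

definition ou_G :: "(real \<Rightarrow> real) \<Rightarrow> real \<Rightarrow> real \<Rightarrow> real" where
  "ou_G \<beta> a b = exp (- (LBINT v=a..b. \<beta> v))"

definition ou_I :: "(real \<Rightarrow> real) \<Rightarrow> (real \<Rightarrow> real) \<Rightarrow> real \<Rightarrow> real \<Rightarrow> real" where
  "ou_I \<alpha> \<beta> s t = (LBINT u=s..t. \<alpha> u * ou_G \<beta> u s)"

definition ou_K :: "(real \<Rightarrow> real) \<Rightarrow> (real \<Rightarrow> real) \<Rightarrow> real \<Rightarrow> real \<Rightarrow> real" where
  "ou_K \<beta> \<sigma> s t = (LBINT u=s..t. \<sigma> s * ou_G \<beta> s u)"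

text \<open>\<open>y\<close> is the value of \<open>\<lambda>\<^sub>s\<close>.\<close>

definition ou_M :: "(real \<Rightarrow> real) \<Rightarrow> (real \<Rightarrow> real) \<Rightarrow> real \<Rightarrow> real \<Rightarrow> real \<Rightarrow> real" where
  "ou_M \<alpha> \<beta> s t y =
     (t - s) * y + (LBINT u=s..t. (t - u) * (\<alpha> u - \<beta> u * ou_G \<beta> s u * (y + ou_I \<alpha> \<beta> s u)))"

definition ou_V :: "(real \<Rightarrow> real) \<Rightarrow> (real \<Rightarrow> real) \<Rightarrow> real \<Rightarrow> real \<Rightarrow> real" where
  "ou_V \<beta> \<sigma> s t = (LBINT u=s..t. (ou_K \<beta> \<sigma> u t)\<^sup>2)"

end

theory Submission
  imports Defs
begin

text \<open>Write \<open>L(u) = \<integral>\<^sub>u\<^sup>t G(u, v) dv\<close>, so that \<open>K(u, t) = \<sigma>(u) L(u)\<close>, \<open>L(t) = 0\<close> and \<open>L' = \<beta> L - 1\<close>. Put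
  \<open>h = 1 - \<beta> L = - L'\<close> and \<open>Z\<^sub>u = \<lambda>\<^sub>u - \<lambda>\<^sub>s - \<integral>\<^sub>s\<^sup>u (\<alpha> - \<beta> \<lambda>) dv\<close>, a continuous version of \<open>\<integral>\<^sub>s\<^sup>u \<sigma> dW\<close>.
  Integrating the derivative of the absolutely continuous function \<open>L (\<lambda> - Z)\<close> over \<open>[s, t]\<close> gives, path by path,
  \<open>\<Lambda> = L(s) \<lambda>\<^sub>s + \<integral> \<alpha> L du + \<integral> h Z du\<close>; the same identity for the mean, where \<open>Z = 0\<close>, shows that
  the first two terms are \<open>M(s, t)\<close>. No stochastic Fubini theorem is needed for \<open>\<integral> h Z du\<close>: it is the almost
  sure limit of Riemann sums \<open>\<Sum>\<^sub>i a\<^sub>i Z(q\<^sub>i)\<close>, which are Wiener integrals of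
  \<open>\<sigma> \<Sum>\<^sub>i a\<^sub>i 1\<^bsub>[s, q\<^sub>i]\<^esub> \<rightarrow> \<sigma> L\<close>. So characteristic functions converge, and \<open>\<integral> h Z du\<close> is independent
  of \<open>F\<^sub>s\<close> with law \<open>N(0, V(s, t))\<close>.\<close>

text \<open>Three obstacles shape the proof. The functions \<alpha> and \<beta> are only integrable,
  so differential identities hold only almost everywhere and are stated in integrated form. The Ito
  integral is defined through simple integrands with random values, even for the deterministic
  \<sigma>, and their integrals need not be Gaussian; deterministic approximants have to be
  recovered before a law can be read off. Finally, the noise is given as a separate version for each
  time, tied to the path only almost surely at that time. Riemann sums evaluate it at countably many
  times, so that one null set covers them all. Limits are taken in characteristic functions because
  their integrands are bounded by 1, whereas the exponentials of the Laplace transform have no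
  evident dominating function; only the limit law is converted into an exponential moment.
  Integrating over an arbitrary event of \<open>F s\<close> throughout carries the independence of
  \<open>F s\<close> along, and it is also the form that characterises a conditional
  expectation.\<close>

section \<open>Absolutely continuous functions\<close>

text \<open>\<open>P\<close> is absolutely continuous on \<open>[a, b]\<close> with almost everywhere derivative \<open>p\<close>.\<close>

definition ac_on :: "real \<Rightarrow> real \<Rightarrow> (real \<Rightarrow> real) \<Rightarrow> (real \<Rightarrow> real) \<Rightarrow> bool" where
  "ac_on a b P p \<longleftrightarrow> set_integrable lborel {a..b} p \<and>
     (\<forall>u\<in>{a..b}. P u = P a + (LINT v:{a..u}|lborel. p v))"

lemma ac_onI:
  assumes "set_integrable lborel {a..b} p"
    and "\<And>u. a \<le> u \<Longrightarrow> u \<le> b \<Longrightarrow> P u = P a + (LINT v:{a..u}|lborel. p v)"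
  shows "ac_on a b P p"
  using assms unfolding ac_on_def by (meson atLeastAtMost_iff)

lemma ac_on_integrable: "ac_on a b P p \<Longrightarrow> set_integrable lborel {a..b} p"
  by (simp add: ac_on_def)

lemma ac_on_eq:
  assumes "ac_on a b P p" "a \<le> u" "u \<le> b"
  shows "P u = P a + (LINT v:{a..u}|lborel. p v)"
  using assms unfolding ac_on_def by (meson atLeastAtMost_iff)

lemma ac_on_cong:
  assumes "ac_on a b P p"
    and "\<And>u. a \<le> u \<Longrightarrow> u \<le> b \<Longrightarrow> P' u = P u" "\<And>u. a \<le> u \<Longrightarrow> u \<le> b \<Longrightarrow> p' u = p u"
  shows "ac_on a b P' p'"
proof (rule ac_onI)
  show "set_integrable lborel {a..b} p'"
    using ac_on_integrable[OF assms(1)] assms(3)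
    by (subst set_integrable_cong[OF refl refl, where f'=p]) auto
  fix u assume u: "a \<le> u" "u \<le> b"
  have "(LINT v:{a..u}|lborel. p' v) = (LINT v:{a..u}|lborel. p v)"
    using u assms(3) by (intro set_lebesgue_integral_cong) auto
  then show "P' u = P' a + (LINT v:{a..u}|lborel. p' v)"
    using ac_on_eq[OF assms(1) u] assms(2)[OF u] assms(2)[of a] u by simp
qed

lemma ac_on_indefinite_integral:
  assumes "set_integrable lborel {a..b} p"
  shows "ac_on a b (\<lambda>u. c + (LINT v:{a..u}|lborel. p v)) p"
proof (rule ac_onI[OF assms])
  have "(LINT v:{a..a}|lborel. p v) = 0"
    unfolding set_lebesgue_integral_def
    by (rule integral_eq_zero_AE) (rule AE_I'[of "{a}"], auto simp: indicator_def)
  then show "c + (LINT v:{a..u}|lborel. p v) =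
      c + (LINT v:{a..a}|lborel. p v) + (LINT v:{a..u}|lborel. p v)" for u
    by simp
qed

lemma ac_on_subinterval:
  assumes "ac_on a b P p" "c \<le> b"
  shows "ac_on a c P p"
proof (rule ac_onI)
  show "set_integrable lborel {a..c} p"
    by (rule set_integrable_subset[OF ac_on_integrable[OF assms(1)]]) (use assms in auto)
  show "P u = P a + (LINT v:{a..u}|lborel. p v)" if "a \<le> u" "u \<le> c" for u
    by (rule ac_on_eq[OF assms(1)]) (use that assms(2) in auto)
qed

lemma ac_on_continuous:
  assumes "ac_on a b P p"
  shows "continuous_on {a..b} P"
proof -
  have int: "set_integrable lborel {a..b} p"
    by (rule ac_on_integrable[OF assms])
  have "continuous_on {a..b} (\<lambda>u. integral {a..u} p)"
    by (rule indefinite_integral_continuous_1) (rule set_borel_integral_eq_integral(1)[OF int])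
  then have "continuous_on {a..b} (\<lambda>u. P a + integral {a..u} p)"
    by (intro continuous_intros)
  moreover have "P a + integral {a..u} p = P u" if "u \<in> {a..b}" for u
  proof -
    have "set_integrable lborel {a..u} p"
      by (rule set_integrable_subset[OF int]) (use that in auto)
    then show ?thesis
      using ac_on_eq[OF assms, of u] that by (simp add: set_borel_integral_eq_integral(2))
  qed
  ultimately show ?thesis
    by (rule continuous_on_eq)
qed

section \<open>Product rule and exponential for integrable densities\<close>

lemma continuous_on_Icc_bounded:
  fixes g :: "real \<Rightarrow> real"
  assumes "continuous_on {a..b} g"
  shows "\<exists>B. \<forall>x\<in>{a..b}. \<bar>g x\<bar> \<le> B"
  using compact_continuous_image[OF assms compact_Icc, THEN compact_imp_bounded]
  by (simp add: bounded_iff)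

lemma set_integrable_mult_continuous:
  fixes f g :: "real \<Rightarrow> real"
  assumes f: "set_integrable lborel {a..b} f" and g: "continuous_on {a..b} g"
  shows "set_integrable lborel {a..b} (\<lambda>x. g x * f x)"
proof -
  obtain B where B: "\<And>x. x \<in> {a..b} \<Longrightarrow> \<bar>g x\<bar> \<le> B"
    using continuous_on_Icc_bounded[OF g] by metis
  have ind_f: "(\<lambda>x. indicator {a..b} x *\<^sub>R f x) \<in> borel_measurable lborel"
    using f unfolding set_integrable_def by (rule borel_measurable_integrable)
  have ind_g: "(\<lambda>x. indicator {a..b} x *\<^sub>R g x) \<in> borel_measurable lborel"
    using borel_measurable_continuous_on_indicator[OF _ g] by simp
  \<comment> \<open>Each factor keeps its own indicator because \<open>f\<close> and
    \<open>g\<close> are controlled only on the interval; the product of the two indicators is again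
    the indicator.\<close>
  have "integrable lborel (\<lambda>x. (indicator {a..b} x *\<^sub>R g x) * (indicator {a..b} x *\<^sub>R f x))"
  proof (rule Bochner_Integration.integrable_bound)
    show "integrable lborel (\<lambda>x. B * (indicator {a..b} x *\<^sub>R f x))"
      using f by (intro integrable_mult_right) (simp add: set_integrable_def)
    show "AE x in lborel. norm ((indicator {a..b} x *\<^sub>R g x) * (indicator {a..b} x *\<^sub>R f x))
        \<le> norm (B * (indicator {a..b} x *\<^sub>R f x))"
    proof (rule AE_I2)
      fix x
      show "norm ((indicator {a..b} x *\<^sub>R g x) * (indicator {a..b} x *\<^sub>R f x))
        \<le> norm (B * (indicator {a..b} x *\<^sub>R f x))"
        using B[of x] by (auto simp: indicator_def abs_mult intro!: mult_right_mono)
    qed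
  qed (intro borel_measurable_times ind_f ind_g)
  moreover have "(indicator {a..b} x *\<^sub>R g x) * (indicator {a..b} x *\<^sub>R f x) =
      indicator {a..b} x *\<^sub>R (g x * f x)" for x
    by (simp add: indicator_def)
  ultimately show ?thesis
    unfolding set_integrable_def by (simp only:)
qed

text \<open>The square over \<open>{a..b}\<close> is cut along its diagonal and each triangle is
  integrated with its smaller variable inside. Fubini's theorem thus does the work of integration by
  parts.\<close>

lemma set_integral_prod_triangle:
  fixes f g :: "real \<Rightarrow> real"
  assumes f: "set_integrable lborel {a..b} f" and g: "set_integrable lborel {a..b} g"
  shows "(LINT u:{a..b}|lborel. f u) * (LINT u:{a..b}|lborel. g u) =
    (LINT u:{a..b}|lborel. f u * (LINT v:{a..u}|lborel. g v)) +
    (LINT u:{a..b}|lborel. (LINT v:{a..u}|lborel. f v) * g u)"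
proof -
  define f' where "f' u = indicator {a..b} u *\<^sub>R f u" for u
  define g' where "g' u = indicator {a..b} u *\<^sub>R g u" for u
  have f'[simp, intro]: "integrable lborel f'" and g'[simp, intro]: "integrable lborel g'"
    using f g by (auto simp: f'_def[abs_def] g'_def[abs_def] set_integrable_def)
  have [measurable]: "f' \<in> borel_measurable lborel" "g' \<in> borel_measurable lborel"
    using f' g' by blast+
  have prod: "integrable (lborel \<Otimes>\<^sub>M lborel) (\<lambda>(u, v). f' u * g' v)"
    by (rule lborel_pair.Fubini_integrable)
      (auto simp: abs_mult intro!: integrable_mult_left integrable_abs)
  \<comment> \<open>The strict inequality puts the diagonal into one triangle only, so that
    \<open>split\<close> below is exact for every \<open>u\<close>.\<close>
  have prod': "integrable (lborel \<Otimes>\<^sub>M lborel) (\<lambda>(u, v). f' u * (indicator {u<..} v * g' v))"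
  proof (rule Bochner_Integration.integrable_bound[OF prod])
    have [measurable]: "(\<lambda>p::real \<times> real. if fst p < snd p then 1 else 0 :: real)
        \<in> borel_measurable (lborel \<Otimes>\<^sub>M lborel)"
      by measurable
    have "indicator {u<..} v = (if fst (u, v) < snd (u, v) then 1 else 0 :: real)" for u v :: real
      by (simp add: indicator_def)
    note eq = this[unfolded fst_conv snd_conv]
    show "(\<lambda>(u, v). f' u * (indicator {u<..} v * g' v)) \<in> borel_measurable (lborel \<Otimes>\<^sub>M lborel)"
      unfolding case_prod_beta eq by measurable
  qed (auto simp: indicator_def)
  have low: "(LINT v|lborel. indicator {..u} v * g' v) = (LINT v:{a..u}|lborel. g v)"
    if "u \<in> {a..b}" for u
    unfolding set_lebesgue_integral_def g'_def using that
    by (intro Bochner_Integration.integral_cong) (auto simp: indicator_def)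
  have up: "(LINT u|lborel. f' u * (indicator {u<..} v * g' v)) = (LINT u:{a..v}|lborel. f u) * g' v"
    if "v \<in> {a..b}" for v
  proof -
    have "(LINT u|lborel. f' u * (indicator {u<..} v * g' v)) =
        (LINT u|lborel. (indicator {a..v} u *\<^sub>R f u) * g' v)"
    proof (rule integral_cong_AE)
      \<comment> \<open>The two integrands differ at most in the single point
        \<open>v\<close>.\<close>
      show "AE u in lborel. f' u * (indicator {u<..} v * g' v) =
          (indicator {a..v} u *\<^sub>R f u) * g' v"
        using AE_lborel_singleton[of v]
        by eventually_elim (use that in \<open>auto simp: indicator_def f'_def\<close>)
      have eq: "indicator {u<..} v = indicator {..<v} u" for u
        by (auto simp: indicator_def)
      show "(\<lambda>u. f' u * (indicator {u<..} v * g' v)) \<in> borel_measurable lborel"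
        unfolding eq by measurable
      have "set_integrable lborel {a..v} f"
        by (rule set_integrable_subset[OF f]) (use that in auto)
      then show "(\<lambda>u. (indicator {a..v} u *\<^sub>R f u) * g' v) \<in> borel_measurable lborel"
        by (auto simp: set_integrable_def)
    qed
    then show ?thesis
      by (simp add: set_lebesgue_integral_def)
  qed
  have int_low: "integrable lborel (\<lambda>v. indicator {..u} v * g' v)" for u
    using integrable_mult_indicator[OF _ g', of "{..u}"] by simp
  have int_up: "integrable lborel (\<lambda>v. indicator {u<..} v * g' v)" for u
    using integrable_mult_indicator[OF _ g', of "{u<..}"] by simp
  have split: "(LINT v|lborel. f' u * g' v) =
      f' u * (LINT v|lborel. indicator {..u} v * g' v) +
      (LINT v|lborel. f' u * (indicator {u<..} v * g' v))" for u
  proof -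
    have "(LINT v|lborel. g' v) = (LINT v|lborel. indicator {..u} v * g' v + indicator {u<..} v * g' v)"
      by (rule Bochner_Integration.integral_cong) (auto simp: indicator_def)
    then show ?thesis
      using int_low int_up by (simp add: distrib_left)
  qed
  have int1: "integrable lborel (\<lambda>u. f' u * (LINT v|lborel. indicator {..u} v * g' v))"
  proof -
    \<comment> \<open>The lower triangle is the square minus the upper triangle, and both have
      integrable sections by Fubini.\<close>
    have "integrable lborel (\<lambda>u. (LINT v|lborel. f' u * g' v) -
        (LINT v|lborel. f' u * (indicator {u<..} v * g' v)))"
      using lborel_pair.integrable_fst[OF prod] lborel_pair.integrable_fst[OF prod']
      by (rule Bochner_Integration.integrable_diff)
    then show ?thesis
      unfolding split by simp
  qed
  have "(LINT u:{a..b}|lborel. f u) * (LINT u:{a..b}|lborel. g u) =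
      (LINT u|lborel. (LINT v|lborel. f' u * g' v))"
    by (simp add: set_lebesgue_integral_def f'_def[abs_def] g'_def[abs_def])
  also have "\<dots> = (LINT u|lborel. f' u * (LINT v|lborel. indicator {..u} v * g' v)) +
      (LINT u|lborel. (LINT v|lborel. f' u * (indicator {u<..} v * g' v)))"
    unfolding split using int1 lborel_pair.integrable_fst[OF prod']
    by (rule Bochner_Integration.integral_add)
  also have "(LINT u|lborel. f' u * (LINT v|lborel. indicator {..u} v * g' v)) =
      (LINT u:{a..b}|lborel. f u * (LINT v:{a..u}|lborel. g v))"
    unfolding set_lebesgue_integral_def[of lborel "{a..b}"]
  proof (intro Bochner_Integration.integral_cong refl)
    fix u
    show "f' u * (LINT v|lborel. indicator {..u} v * g' v) =
        indicator {a..b} u *\<^sub>R (f u * (LINT v:{a..u}|lborel. g v))"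
      by (cases "u \<in> {a..b}") (simp_all add: low, simp_all add: f'_def)
  qed
  also have "(LINT u|lborel. (LINT v|lborel. f' u * (indicator {u<..} v * g' v))) =
      (LINT v|lborel. (LINT u|lborel. f' u * (indicator {u<..} v * g' v)))"
    using lborel_pair.Fubini_integral[OF prod'] by simp
  also have "\<dots> = (LINT u:{a..b}|lborel. (LINT v:{a..u}|lborel. f v) * g u)"
    unfolding set_lebesgue_integral_def[of lborel "{a..b}"]
  proof (intro Bochner_Integration.integral_cong refl)
    fix v
    show "(LINT u|lborel. f' u * (indicator {u<..} v * g' v)) =
        indicator {a..b} v *\<^sub>R ((LINT u:{a..v}|lborel. f u) * g v)"
      by (cases "v \<in> {a..b}") (simp_all add: up, simp_all add: g'_def)
  qed
  finally show ?thesis .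
qed

text \<open>The triangle identity for \<open>p\<close> and \<open>r\<close> evaluates
  \<open>(P u - P a) * (R u - R a)\<close>; after expansion the boundary terms cancel.\<close>

lemma ac_on_mult:
  assumes P: "ac_on a b P p" and R: "ac_on a b R r"
  shows "ac_on a b (\<lambda>u. P u * R u) (\<lambda>u. p u * R u + P u * r u)"
proof -
  have cont: "continuous_on {a..b} P" "continuous_on {a..b} R"
    using P R ac_on_continuous by blast+
  have int: "set_integrable lborel {a..b} (\<lambda>u. p u * R u)" "set_integrable lborel {a..b} (\<lambda>u. P u * r u)"
    using set_integrable_mult_continuous[OF ac_on_integrable[OF P] cont(2)]
      set_integrable_mult_continuous[OF ac_on_integrable[OF R] cont(1)]
    by (simp_all add: mult.commute)
  show ?thesis
  proof (rule ac_onI)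
    show "set_integrable lborel {a..b} (\<lambda>u. p u * R u + P u * r u)"
      using int by (rule set_integral_add)
    fix u assume u: "a \<le> u" "u \<le> b"
    have sub: "set_integrable lborel {a..u} k" if "set_integrable lborel {a..b} k" for k :: "real \<Rightarrow> real"
      by (rule set_integrable_subset[OF that]) (use u in auto)
    have p: "set_integrable lborel {a..u} p" and r: "set_integrable lborel {a..u} r"
      using P R ac_on_integrable sub by blast+
    have Peq: "(LINT w:{a..v}|lborel. p w) = P v - P a" and Req: "(LINT w:{a..v}|lborel. r w) = R v - R a"
      if "v \<in> {a..u}" for v
      using ac_on_eq[OF P, of v] ac_on_eq[OF R, of v] that u by auto
    have "(LINT v:{a..u}|lborel. p v) * (LINT v:{a..u}|lborel. r v) =
        (LINT v:{a..u}|lborel. p v * (R v - R a)) + (LINT v:{a..u}|lborel. (P v - P a) * r v)"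
      unfolding set_integral_prod_triangle[OF p r]
      by (intro arg_cong2[where f="(+)"] set_lebesgue_integral_cong) (auto simp: Peq Req)
    also have "\<dots> = (LINT v:{a..u}|lborel. p v * R v) - R a * (LINT v:{a..u}|lborel. p v)
        + ((LINT v:{a..u}|lborel. P v * r v) - P a * (LINT v:{a..u}|lborel. r v))"
      using sub[OF int(1)] sub[OF int(2)] p r
      by (simp add: algebra_simps set_integral_diff)
    finally have "(P u - P a) * (R u - R a) = (LINT v:{a..u}|lborel. p v * R v) - R a * (P u - P a)
        + ((LINT v:{a..u}|lborel. P v * r v) - P a * (R u - R a))"
      using Peq[of u] Req[of u] u by simp
    moreover have "(LINT v:{a..u}|lborel. p v * R v + P v * r v) =
        (LINT v:{a..u}|lborel. p v * R v) + (LINT v:{a..u}|lborel. P v * r v)"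
      using sub[OF int(1)] sub[OF int(2)] by (rule set_integral_add)
    ultimately show "P u * R u = P a * R a + (LINT v:{a..u}|lborel. p v * R v + P v * r v)"
      by (simp add: algebra_simps)
  qed
qed

lemma ac_on_minus:
  assumes "ac_on a b P p"
  shows "ac_on a b (\<lambda>u. - P u) (\<lambda>u. - p u)"
proof (rule ac_onI)
  show "set_integrable lborel {a..b} (\<lambda>u. - p u)"
    using ac_on_integrable[OF assms] by (simp add: set_integrable_def)
  show "- P u = - P a + (LINT v:{a..u}|lborel. - p v)" if "a \<le> u" "u \<le> b" for u
    using ac_on_eq[OF assms that]
    by (simp add: set_integral_uminus ac_on_integrable[OF ac_on_subinterval[OF assms that(2)]])
qed

lemma ac_on_power:
  assumes P: "ac_on a b P p"
  shows "ac_on a b (\<lambda>u. P u ^ Suc n) (\<lambda>u. real (Suc n) * (P u ^ n * p u))"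
proof (induction n)
  case 0
  show ?case by (rule ac_on_cong[OF P]) simp_all
next
  case (Suc n)
  show ?case
    by (rule ac_on_cong[OF ac_on_mult[OF P Suc]]) (simp_all add: algebra_simps)
qed

text \<open>With densities that are merely integrable there is no chain rule to appeal to; the product
  rule gives the powers of \<open>P\<close>, and summing the exponential series gives \<open>exp P\<close>.\<close>

lemma ac_on_exp:
  assumes P: "ac_on a b P p"
  shows "ac_on a b (\<lambda>u. exp (P u)) (\<lambda>u. exp (P u) * p u)"
proof (rule ac_onI)
  have cont: "continuous_on {a..b} P"
    using P by (rule ac_on_continuous)
  show int: "set_integrable lborel {a..b} (\<lambda>u. exp (P u) * p u)"
    by (intro set_integrable_mult_continuous ac_on_integrable[OF P] continuous_intros cont)
  fix u assume u: "a \<le> u" "u \<le> b"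
  obtain B where B: "\<And>x. x \<in> {a..b} \<Longrightarrow> \<bar>P x\<bar> \<le> B"
    using continuous_on_Icc_bounded[OF cont] by metis
  have sub: "ac_on a u P p"
    using P u(2) by (rule ac_on_subinterval)
  \<comment> \<open>\<open>q n\<close> is the density of \<open>P ^ Suc n / fact (Suc n)\<close> on
    \<open>{a..u}\<close>, so the \<open>q n\<close> add up to the density of \<open>exp P\<close>.
    The bound \<open>B\<close> on \<open>P\<close> supplies a summable majorant.\<close>
  define q where "q n v = indicator {a..u} v *\<^sub>R (P v ^ n * p v / fact n)" for n v
  have int_q: "integrable lborel (q n)" for n
  proof -
    have "continuous_on {a..u} (\<lambda>v. P v ^ n / fact n)"
      by (intro continuous_intros ac_on_continuous[OF sub]) simp
    from set_integrable_mult_continuous[OF ac_on_integrable[OF sub] this]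
    show ?thesis
      by (simp add: q_def[abs_def] set_integrable_def)
  qed
  have int_p: "integrable lborel (\<lambda>v. \<bar>indicator {a..u} v *\<^sub>R p v\<bar>)"
    using ac_on_integrable[OF sub] by (intro integrable_abs) (simp add: set_integrable_def)
  have q_sums: "(\<lambda>n. q n v) sums (indicator {a..u} v *\<^sub>R (exp (P v) * p v))" for v
    using sums_mult2[OF exp_converges[of "P v"], of "indicator {a..u} v * p v"]
    by (simp add: q_def divide_inverse mult_ac)
  have q_bound: "\<bar>q n v\<bar> \<le> B ^ n / fact n * \<bar>indicator {a..u} v *\<^sub>R p v\<bar>" for n v
  proof (cases "v \<in> {a..u}")
    case True
    then have "\<bar>P v\<bar> ^ n \<le> B ^ n"
      using u by (intro power_mono B) auto
    then show ?thesis
      using True by (auto simp: q_def abs_mult power_abs divide_right_mono mult_right_mono)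
  qed (simp add: q_def)
  have B_summable: "summable (\<lambda>n. B ^ n / fact n * c)" for c :: real
    using summable_mult2[OF summable_exp_generic[of B], of c] by (simp add: divide_inverse mult_ac)
  have "(\<lambda>n. integral\<^sup>L lborel (q n)) sums (LINT v|lborel. (\<Sum>n. q n v))"
  proof (rule sums_integral[OF int_q])
    show "AE v in lborel. summable (\<lambda>n. norm (q n v))"
    proof (rule AE_I2)
      fix v show "summable (\<lambda>n. norm (q n v))"
        by (rule summable_comparison_test'[OF B_summable[of "\<bar>indicator {a..u} v *\<^sub>R p v\<bar>"]])
          (use q_bound in simp)
    qed
    show "summable (\<lambda>n. LINT v|lborel. norm (q n v))"
    proof (rule summable_comparison_test'[OF B_summable[of "LINT v|lborel. \<bar>indicator {a..u} v *\<^sub>R p v\<bar>"]])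
      fix n
      have "(LINT v|lborel. norm (q n v)) \<le>
          (LINT v|lborel. B ^ n / fact n * \<bar>indicator {a..u} v *\<^sub>R p v\<bar>)"
        using int_q int_p q_bound
        by (intro integral_mono integrable_norm integrable_mult_right) auto
      then show "norm (LINT v|lborel. norm (q n v)) \<le>
          B ^ n / fact n * (LINT v|lborel. \<bar>indicator {a..u} v *\<^sub>R p v\<bar>)"
        by (subst (asm) integral_mult_right_zero) simp
    qed
  qed
  also have "(LINT v|lborel. (\<Sum>n. q n v)) = (LINT v:{a..u}|lborel. exp (P v) * p v)"
    unfolding set_lebesgue_integral_def
    by (simp add: sums_unique[OF q_sums, symmetric])
  also have "(\<lambda>n. integral\<^sup>L lborel (q n)) = (\<lambda>n. P u ^ Suc n / fact (Suc n) - P a ^ Suc n / fact (Suc n))"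
  proof
    fix n
    have "P u ^ Suc n = P a ^ Suc n + (LINT v:{a..u}|lborel. Suc n * (P v ^ n * p v))"
      by (rule ac_on_eq[OF ac_on_power[OF P] u])
    also have "(LINT v:{a..u}|lborel. Suc n * (P v ^ n * p v)) = (LINT v|lborel. fact (Suc n) * q n v)"
      unfolding set_lebesgue_integral_def
      by (rule Bochner_Integration.integral_cong) (auto simp: q_def)
    also have "\<dots> = fact (Suc n) * integral\<^sup>L lborel (q n)"
      by (rule integral_mult_right_zero)
    finally show "integral\<^sup>L lborel (q n) = P u ^ Suc n / fact (Suc n) - P a ^ Suc n / fact (Suc n)"
      by (simp add: field_simps del: fact_Suc)
  qed
  finally have "(\<lambda>n. P u ^ Suc n / fact (Suc n) - P a ^ Suc n / fact (Suc n)) sums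
      (LINT v:{a..u}|lborel. exp (P v) * p v)" .
  \<comment> \<open>The series starts at the first power, hence \<open>exp - 1\<close> at both ends;
    the ones cancel.\<close>
  moreover have "(\<lambda>n. P u ^ Suc n / fact (Suc n) - P a ^ Suc n / fact (Suc n)) sums
      ((exp (P u) - 1) - (exp (P a) - 1))"
  proof (rule sums_diff)
    have *: "(\<lambda>n. z ^ Suc n / fact (Suc n)) sums (exp z - 1)" for z :: real
    proof -
      have "(\<lambda>n. z ^ n / fact n) sums (exp z)"
        using exp_converges[of z] by (simp add: divide_inverse mult_ac)
      then show ?thesis
        by (intro iffD2[OF sums_Suc_iff[of "\<lambda>n. z ^ n / fact n"]]) simp
    qed
    show "(\<lambda>n. P u ^ Suc n / fact (Suc n)) sums (exp (P u) - 1)"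
      "(\<lambda>n. P a ^ Suc n / fact (Suc n)) sums (exp (P a) - 1)"
      by (fact *)+
  qed
  ultimately have "(LINT v:{a..u}|lborel. exp (P v) * p v) = exp (P u) - exp (P a)"
    by (simp add: sums_unique2)
  then show "exp (P u) = exp (P a) + (LINT v:{a..u}|lborel. exp (P v) * p v)"
    by simp
qed

section \<open>The pathwise integrated equation\<close>

text \<open>The response of the time integral up to \<open>t\<close> to a unit shock at time
  \<open>u\<close>. The horizon comes first so that \<open>ou_L \<beta> t\<close> is a function of
  the starting time, the variable in which it is differentiated.\<close>

definition ou_L :: "(real \<Rightarrow> real) \<Rightarrow> real \<Rightarrow> real \<Rightarrow> real" where
  "ou_L \<beta> t u = (LBINT v=u..t. ou_G \<beta> u v)"

lemma ou_K_eq: "ou_K \<beta> \<sigma> u t = \<sigma> u * ou_L \<beta> t u"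
  by (simp add: ou_K_def ou_L_def)

lemma ou_L_self: "ou_L \<beta> t t = 0"
  by (simp add: ou_L_def)

lemma ou_G_eq: "s \<le> u \<Longrightarrow> ou_G \<beta> s u = exp (- (LINT v:{s..u}|lborel. \<beta> v))"
  by (simp add: ou_G_def interval_integral_Icc)

lemma ou_G_self: "ou_G \<beta> s s = 1"
  by (simp add: ou_G_def)

lemma ou_G_reverse: "ou_G \<beta> u s = inverse (ou_G \<beta> s u)"
  unfolding ou_G_def interval_integral_endpoints_reverse[of u s] by (simp add: exp_minus)

lemma ou_G_nonzero: "ou_G \<beta> s u \<noteq> 0"
  by (simp add: ou_G_def)

lemma interval_integrable_Icc:
  fixes a b :: real and f :: "real \<Rightarrow> real"
  assumes "set_integrable lborel {a..b} f" "a \<le> b"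
  shows "interval_lebesgue_integrable lborel a b f"
  using assms by (auto simp: interval_lebesgue_integrable_def intro!: set_integrable_subset[OF assms(1)])

lemma set_integral_Icc_split:
  fixes f :: "real \<Rightarrow> real"
  assumes "set_integrable lborel {a..c} f" "a \<le> b" "b \<le> c"
  shows "(LINT u:{a..c}|lborel. f u) = (LINT u:{a..b}|lborel. f u) + (LINT u:{b..c}|lborel. f u)"
proof -
  have "(LBINT x=a..b. f x) + (LBINT x=b..c. f x) = (LBINT x=a..c. f x)"
    using assms by (intro interval_integral_sum) (auto simp: min_def max_def intro!: interval_integrable_Icc)
  then show ?thesis
    using assms by (simp add: interval_integral_Icc)
qed

section \<open>G and L as absolutely continuous functions; the linear equation\<close>

context
  fixes \<beta> :: "real \<Rightarrow> real" and s t :: real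
  assumes st: "s \<le> t"
    and \<beta>: "set_integrable lborel {s..t} \<beta>"
begin

lemma ou_G_mult:
  assumes "s \<le> u" "u \<le> v" "v \<le> t"
  shows "ou_G \<beta> s u * ou_G \<beta> u v = ou_G \<beta> s v"
proof -
  have "set_integrable lborel {s..v} \<beta>"
    by (rule set_integrable_subset[OF \<beta>]) (use assms in auto)
  from set_integral_Icc_split[OF this assms(1,2)] show ?thesis
    using assms by (simp add: ou_G_eq flip: exp_add)
qed

lemma ac_on_ou_G: "ac_on s t (ou_G \<beta> s) (\<lambda>u. - \<beta> u * ou_G \<beta> s u)"
  by (rule ac_on_cong[OF ac_on_exp[OF ac_on_minus[OF ac_on_indefinite_integral[OF \<beta>, of 0]]]])
    (simp_all add: ou_G_eq)

lemma ac_on_ou_G_reverse: "ac_on s t (\<lambda>u. ou_G \<beta> u s) (\<lambda>u. \<beta> u * ou_G \<beta> u s)"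
  by (rule ac_on_cong[OF ac_on_exp[OF ac_on_indefinite_integral[OF \<beta>, of 0]]])
    (simp_all add: ou_G_eq ou_G_reverse[of _ _ s] exp_minus)

text \<open>By the flow property \<open>ou_G_mult\<close>, L(u) is G(u, s) times the integral of
  G(s, v) over \<open>[u, t]\<close>. The product rule gives \<beta> L from the first factor and -
  G(u, s) G(s, u) = - 1 from the second.\<close>

lemma ac_on_ou_L: "ac_on s t (ou_L \<beta> t) (\<lambda>u. \<beta> u * ou_L \<beta> t u - 1)"
proof -
  have G: "set_integrable lborel {a..b} (ou_G \<beta> s)" if "{a..b} \<subseteq> {s..t}" for a b
  proof -
    have "set_integrable lborel {s..t} (ou_G \<beta> s)"
      using ac_on_continuous[OF ac_on_ou_G] by (rule borel_integrable_atLeastAtMost')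
    then show ?thesis
      by (rule set_integrable_subset) (use that in auto)
  qed
  define C where "C = (LINT v:{s..t}|lborel. ou_G \<beta> s v)"
  \<comment> \<open>The double minus is the shape of \<open>ac_on_minus\<close> applied to
    \<open>ac_on_indefinite_integral\<close>.\<close>
  have L: "ou_L \<beta> t u = ou_G \<beta> u s * (- (- C + (LINT v:{s..u}|lborel. ou_G \<beta> s v)))"
    if "s \<le> u" "u \<le> t" for u
  proof -
    have "ou_G \<beta> s u * ou_L \<beta> t u = (LINT v:{u..t}|lborel. ou_G \<beta> s u * ou_G \<beta> u v)"
      using that by (simp add: ou_L_def interval_integral_Icc)
    also have "\<dots> = (LINT v:{u..t}|lborel. ou_G \<beta> s v)"
      using that by (intro set_lebesgue_integral_cong) (auto simp: ou_G_mult)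
    also have "\<dots> = C - (LINT v:{s..u}|lborel. ou_G \<beta> s v)"
      unfolding C_def using set_integral_Icc_split[OF G that] by simp
    finally have "ou_L \<beta> t u = (C - (LINT v:{s..u}|lborel. ou_G \<beta> s v)) / ou_G \<beta> s u"
      using ou_G_nonzero[of \<beta> s u] by (simp add: field_simps)
    then show ?thesis
      by (simp add: ou_G_reverse[of _ u] divide_inverse)
  qed
  show ?thesis
    by (rule ac_on_cong[OF ac_on_mult[OF ac_on_ou_G_reverse
            ac_on_minus[OF ac_on_indefinite_integral[OF G[OF order_refl], of "- C"]]]])
      (simp_all add: L ou_G_reverse[of _ _ s] ou_G_nonzero)
qed

lemma linear_ode_integral:
  fixes \<alpha> y Z :: "real \<Rightarrow> real"
  assumes \<alpha>: "set_integrable lborel {s..t} \<alpha>"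
    and y: "continuous_on {s..t} y"
    and ode: "\<And>u. s \<le> u \<Longrightarrow> u \<le> t \<Longrightarrow> y u = y s + (LINT v:{s..u}|lborel. \<alpha> v - \<beta> v * y v) + Z u"
  shows "(LINT u:{s..t}|lborel. y u) = ou_L \<beta> t s * y s + (LINT u:{s..t}|lborel. \<alpha> u * ou_L \<beta> t u) +
    (LINT u:{s..t}|lborel. (1 - \<beta> u * ou_L \<beta> t u) * Z u)"
proof -
  let ?L = "ou_L \<beta> t"
  \<comment> \<open>\<open>Y\<close> is \<open>y - Z\<close>. The path \<open>Z\<close>, like a
    Brownian path, need not have a density, so the product rule is applied to
    \<open>Y\<close>.\<close>
  define Y where "Y u = y s + (LINT v:{s..u}|lborel. \<alpha> v - \<beta> v * y v)" for u
  have \<beta>y: "set_integrable lborel {s..t} (\<lambda>u. \<beta> u * y u)"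
    using set_integrable_mult_continuous[OF \<beta> y] by (simp add: mult.commute)
  have Y: "ac_on s t Y (\<lambda>u. \<alpha> u - \<beta> u * y u)"
    unfolding Y_def by (intro ac_on_indefinite_integral set_integral_diff \<alpha> \<beta>y)
  note L = ac_on_ou_L
  have L_cont: "continuous_on {s..t} ?L" and Y_cont: "continuous_on {s..t} Y"
    using L Y by (blast intro: ac_on_continuous)+
  have Ys: "Y s = y s"
    using ac_on_eq[OF Y, of s] st ode[of s] unfolding Y_def by (simp add: set_lebesgue_integral_def)
  have Z: "Z u = y u - Y u" if "s \<le> u" "u \<le> t" for u
    using ode[OF that] by (simp add: Y_def)
  have i1: "set_integrable lborel {s..t} (\<lambda>u. (\<beta> u * ?L u - 1) * Y u)"
    using set_integrable_mult_continuous[OF ac_on_integrable[OF L] Y_cont] by (simp add: mult.commute)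
  have i2: "set_integrable lborel {s..t} (\<lambda>u. ?L u * (\<alpha> u - \<beta> u * y u))"
    by (rule set_integrable_mult_continuous[OF ac_on_integrable[OF Y] L_cont])
  have i3: "set_integrable lborel {s..t} (\<lambda>u. \<alpha> u * ?L u)"
    using set_integrable_mult_continuous[OF \<alpha> L_cont] by (simp add: mult.commute)
  have i4: "set_integrable lborel {s..t} y"
    using y by (rule borel_integrable_atLeastAtMost')
  \<comment> \<open>The left side is \<open>?L t * Y t\<close>, which vanishes because
    \<open>?L t = 0\<close>.\<close>
  have "0 = ?L s * y s + (LINT u:{s..t}|lborel. (\<beta> u * ?L u - 1) * Y u + ?L u * (\<alpha> u - \<beta> u * y u))"
    using ac_on_eq[OF ac_on_mult[OF L Y], of t] st by (simp add: ou_L_self Ys)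
  also have "(LINT u:{s..t}|lborel. (\<beta> u * ?L u - 1) * Y u + ?L u * (\<alpha> u - \<beta> u * y u)) =
      (LINT u:{s..t}|lborel. \<alpha> u * ?L u + (1 - \<beta> u * ?L u) * Z u - y u)"
    by (intro set_lebesgue_integral_cong) (auto simp: Z algebra_simps)
  also have "\<dots> = (LINT u:{s..t}|lborel. \<alpha> u * ?L u) +
      (LINT u:{s..t}|lborel. (1 - \<beta> u * ?L u) * Z u) - (LINT u:{s..t}|lborel. y u)"
  proof -
    \<comment> \<open>\<open>Z\<close> is known only through \<open>ode\<close>, so integrability of
      the noise term is read off from its constituents: the sum collapses to
      \<open>(1 - \<beta> u * ?L u) * (y u - Y u)\<close>.\<close>
    have "set_integrable lborel {s..t} (\<lambda>u. (\<beta> u * ?L u - 1) * Y u + ?L u * (\<alpha> u - \<beta> u * y u)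
        - \<alpha> u * ?L u + y u)"
      by (intro set_integral_add set_integral_diff i1 i2 i3 i4)
    then have "set_integrable lborel {s..t} (\<lambda>u. (1 - \<beta> u * ?L u) * Z u)"
      by (subst set_integrable_cong[OF refl refl]) (auto simp: Z algebra_simps)
    with i3 i4 show ?thesis
      by (simp add: set_integral_diff set_integral_add)
  qed
  finally show ?thesis
    by simp
qed

lemma ou_M_eq:
  assumes \<alpha>: "set_integrable lborel {s..t} \<alpha>"
  shows "ou_M \<alpha> \<beta> s t y = ou_L \<beta> t s * y + (LINT u:{s..t}|lborel. \<alpha> u * ou_L \<beta> t u)"
proof -
  \<comment> \<open>Variation of constants: \<open>m\<close> solves the equation without noise,
    started at \<open>y\<close>.\<close>
  define m where "m u = ou_G \<beta> s u * (y + ou_I \<alpha> \<beta> s u)" for u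
  have \<alpha>G: "set_integrable lborel {s..t} (\<lambda>u. \<alpha> u * ou_G \<beta> u s)"
    using set_integrable_mult_continuous[OF \<alpha> ac_on_continuous[OF ac_on_ou_G_reverse]]
    by (simp add: mult.commute)
  have m: "ac_on s t m (\<lambda>u. \<alpha> u - \<beta> u * m u)"
    by (rule ac_on_cong[OF ac_on_mult[OF ac_on_ou_G ac_on_indefinite_integral[OF \<alpha>G, of y]]])
      (simp_all add: m_def ou_I_def interval_integral_Icc ou_G_reverse[of _ _ s] ou_G_nonzero)
  have ms: "m s = y"
    by (simp add: m_def ou_I_def ou_G_self)
  have "(LINT u:{s..t}|lborel. m u) = ou_L \<beta> t s * y + (LINT u:{s..t}|lborel. \<alpha> u * ou_L \<beta> t u)"
    using linear_ode_integral[OF \<alpha> ac_on_continuous[OF m], of "\<lambda>_. 0"] ac_on_eq[OF m]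
    by (simp add: ms)
  moreover have "(LINT u:{s..t}|lborel. m u) = ou_M \<alpha> \<beta> s t y"
  proof -
    \<comment> \<open>The weight \<open>t - u\<close> is the antiderivative of \<open>- 1\<close>
      that vanishes at \<open>t\<close>. Integration by parts against \<open>m\<close> turns the
      integral of \<open>m\<close> into the formula for \<open>ou_M\<close>.\<close>
    have "set_integrable lborel {s..t} (\<lambda>_. - 1 :: real)"
      by (rule borel_integrable_atLeastAtMost') simp
    from ac_on_indefinite_integral[OF this, of "t - s"]
    have T: "ac_on s t (\<lambda>u. t - u) (\<lambda>_. - 1)"
      by (rule ac_on_cong) (auto simp: set_lebesgue_integral_def)
    have "continuous_on {s..t} (\<lambda>u. t - u)"
      by (intro continuous_intros)
    from set_integrable_mult_continuous[OF ac_on_integrable[OF m] this]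
    have "set_integrable lborel {s..t} (\<lambda>u. (t - u) * (\<alpha> u - \<beta> u * m u))" .
    moreover have "set_integrable lborel {s..t} m"
      using ac_on_continuous[OF m] by (rule borel_integrable_atLeastAtMost')
    moreover have "0 = (t - s) * y + (LINT u:{s..t}|lborel. (t - u) * (\<alpha> u - \<beta> u * m u) - m u)"
      using ac_on_eq[OF ac_on_mult[OF T m], of t] st by (simp add: ms)
    ultimately have "(LINT u:{s..t}|lborel. m u) = (t - s) * y + (LINT u:{s..t}|lborel. (t - u) * (\<alpha> u - \<beta> u * m u))"
      by (simp add: set_integral_diff)
    then show ?thesis
      using st by (simp add: ou_M_def m_def interval_integral_Icc mult.assoc)
  qed
  ultimately show ?thesis by simp
qed

end

section \<open>Riemann sums\<close>

text \<open>Cells of width \<open>1 / Suc n\<close> are counted from \<open>s\<close> and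
  represented by their left endpoints. These stay in \<open>{s..t}\<close> although \<open>t\<close>
  may fall inside a cell, and all grids together have countably many points.\<close>

definition grid_index :: "real \<Rightarrow> nat \<Rightarrow> real \<Rightarrow> nat" where
  "grid_index s n v = nat \<lfloor>real (Suc n) * (v - s)\<rfloor>"

definition grid_point :: "real \<Rightarrow> nat \<Rightarrow> nat \<Rightarrow> real" where
  "grid_point s n i = s + real i / real (Suc n)"

text \<open>A cell is weighted by the exact integral of \<open>h\<close> over it, not by a value of
  \<open>h\<close> times the width, since point values of an integrable function carry no
  information.\<close>

definition cell_integral :: "real \<Rightarrow> real \<Rightarrow> (real \<Rightarrow> real) \<Rightarrow> nat \<Rightarrow> nat \<Rightarrow> real" where
  "cell_integral s t h n i = (LINT v:{s..t}|lborel. h v * indicator {i} (grid_index s n v))"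

lemma grid_point_ge: "s \<le> grid_point s n i"
  by (simp add: grid_point_def)

lemma grid_index_mono: "u \<le> v \<Longrightarrow> grid_index s n u \<le> grid_index s n v"
  unfolding grid_index_def by (intro nat_mono floor_mono mult_left_mono) auto

lemma grid_point_grid_index:
  assumes "s \<le> v"
  shows "grid_point s n (grid_index s n v) \<le> v"
    and "v - 1 / real (Suc n) \<le> grid_point s n (grid_index s n v)"
proof -
  have eq: "real (grid_index s n v) = of_int \<lfloor>real (Suc n) * (v - s)\<rfloor>"
    using assms by (simp add: grid_index_def)
  have 1: "real (grid_index s n v) \<le> real (Suc n) * (v - s)"
    and 2: "real (Suc n) * (v - s) - 1 \<le> real (grid_index s n v)"
    unfolding eq by linarith+
  show "grid_point s n (grid_index s n v) \<le> v"
    using 1 by (simp add: grid_point_def field_simps)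
  show "v - 1 / real (Suc n) \<le> grid_point s n (grid_index s n v)"
    using divide_right_mono[OF 2, of "real (Suc n)"]
    by (simp add: grid_point_def diff_divide_distrib del: of_nat_Suc)
qed

lemma grid_point_le:
  assumes "s \<le> t" "i \<le> grid_index s n t"
  shows "grid_point s n i \<le> t"
proof -
  have "grid_point s n i \<le> grid_point s n (grid_index s n t)"
    using assms(2) by (auto simp: grid_point_def divide_right_mono)
  also have "\<dots> \<le> t"
    by (rule grid_point_grid_index(1)[OF assms(1)])
  finally show ?thesis .
qed

lemma grid_point_tendsto:
  assumes "s \<le> v"
  shows "(\<lambda>n. grid_point s n (grid_index s n v)) \<longlonglongrightarrow> v"
proof (rule tendsto_sandwich)
  show "(\<lambda>n. v - 1 / real (Suc n)) \<longlonglongrightarrow> v"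
    using tendsto_diff[OF tendsto_const LIMSEQ_inverse_real_of_nat, of v] by (simp add: inverse_eq_divide)
  show "(\<lambda>n. v) \<longlonglongrightarrow> v"
    by (rule tendsto_const)
  show "\<forall>\<^sub>F n in sequentially. v - 1 / real (Suc n) \<le> grid_point s n (grid_index s n v)"
    "\<forall>\<^sub>F n in sequentially. grid_point s n (grid_index s n v) \<le> v"
    using grid_point_grid_index[OF assms] by (auto intro: always_eventually)
qed

lemma grid_index_measurable [measurable]: "grid_index s n \<in> borel \<rightarrow>\<^sub>M count_space UNIV"
  unfolding grid_index_def[abs_def] by measurable

context
  fixes s t :: real and h :: "real \<Rightarrow> real"
  assumes h: "set_integrable lborel {s..t} h"
begin

lemma set_integrable_cell: "set_integrable lborel {s..t} (\<lambda>v. h v * indicator {i} (grid_index s n v))"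
proof -
  have "integrable lborel (\<lambda>v. indicator (grid_index s n -` {i}) v *\<^sub>R (indicator {s..t} v *\<^sub>R h v))"
    using h unfolding set_integrable_def
    by (rule integrable_mult_indicator[rotated]) (simp add: measurable_sets_borel[OF grid_index_measurable])
  moreover have "indicator (grid_index s n -` {i}) v *\<^sub>R (indicator {s..t} v *\<^sub>R h v) =
      indicator {s..t} v *\<^sub>R (h v * indicator {i} (grid_index s n v))" for v
    by (simp add: indicator_def)
  ultimately show ?thesis
    unfolding set_integrable_def by (simp only:)
qed

lemma step_expansion:
  fixes g :: "nat \<Rightarrow> real"
  assumes "v \<in> {s..t}"
  shows "h v * g (grid_index s n v) =
    (\<Sum>i\<le>grid_index s n t. g i * (h v * indicator {i} (grid_index s n v)))"
proof -
  have "(\<Sum>i\<le>grid_index s n t. g i * (h v * indicator {i} (grid_index s n v))) =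
      (\<Sum>i\<in>{grid_index s n v}. g i * (h v * indicator {i} (grid_index s n v)))"
    using assms by (intro sum.mono_neutral_right) (auto simp: grid_index_mono)
  then show ?thesis
    by simp
qed

text \<open>Exact cell weights make the grid sum an integral of \<open>h\<close> against a step
  function, so that limits of grid sums reduce to dominated convergence.\<close>

lemma
  fixes g :: "nat \<Rightarrow> real"
  shows set_integrable_step: "set_integrable lborel {s..t} (\<lambda>v. h v * g (grid_index s n v))"
    and set_integral_step: "(LINT v:{s..t}|lborel. h v * g (grid_index s n v)) =
      (\<Sum>i\<le>grid_index s n t. cell_integral s t h n i * g i)"
proof -
  let ?G = "\<lambda>v. \<Sum>i\<le>grid_index s n t. g i * (h v * indicator {i} (grid_index s n v))"
  have int: "set_integrable lborel {s..t} (\<lambda>v. g i * (h v * indicator {i} (grid_index s n v)))" for i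
    by (intro set_integrable_mult_right set_integrable_cell)
  have "set_integrable lborel {s..t} ?G"
    using Bochner_Integration.integrable_sum[of "{..grid_index s n t}", OF int[unfolded set_integrable_def]]
    unfolding set_integrable_def scaleR_sum_right .
  moreover have "set_integrable lborel {s..t} (\<lambda>v. h v * g (grid_index s n v)) \<longleftrightarrow>
      set_integrable lborel {s..t} ?G"
    by (rule set_integrable_cong[OF refl refl step_expansion])
  ultimately show "set_integrable lborel {s..t} (\<lambda>v. h v * g (grid_index s n v))"
    by simp
  have "(LINT v:{s..t}|lborel. h v * g (grid_index s n v)) = (LINT v:{s..t}|lborel. ?G v)"
    by (rule set_lebesgue_integral_cong) (simp_all add: step_expansion[of _ g n])
  also have "\<dots> = (\<Sum>i\<le>grid_index s n t. LINT v:{s..t}|lborel. g i * (h v * indicator {i} (grid_index s n v)))"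
    using Bochner_Integration.integral_sum[of "{..grid_index s n t}", OF int[unfolded set_integrable_def]]
    unfolding set_lebesgue_integral_def scaleR_sum_right .
  also have "\<dots> = (\<Sum>i\<le>grid_index s n t. cell_integral s t h n i * g i)"
    by (simp add: cell_integral_def mult.commute)
  finally show "(LINT v:{s..t}|lborel. h v * g (grid_index s n v)) =
      (\<Sum>i\<le>grid_index s n t. cell_integral s t h n i * g i)" .
qed

text \<open>The bound is uniform in \<open>n\<close>; with an indicator for \<open>g\<close> it
  dominates the integrands of the approximating Wiener integrals.\<close>

lemma grid_sum_bound:
  assumes "\<And>r. s \<le> r \<Longrightarrow> r \<le> t \<Longrightarrow> \<bar>g r\<bar> \<le> B"
  shows "\<bar>\<Sum>i\<le>grid_index s n t. cell_integral s t h n i * g (grid_point s n i)\<bar> \<le>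
    B * (LINT v:{s..t}|lborel. \<bar>h v\<bar>)"
proof -
  have int: "set_integrable lborel {s..t} (\<lambda>v. h v * g (grid_point s n (grid_index s n v)))"
    by (rule set_integrable_step[where g="\<lambda>i. g (grid_point s n i)"])
  have "\<bar>\<Sum>i\<le>grid_index s n t. cell_integral s t h n i * g (grid_point s n i)\<bar> =
      norm (LINT v:{s..t}|lborel. h v * g (grid_point s n (grid_index s n v)))"
    using set_integral_step[of "\<lambda>i. g (grid_point s n i)" n] by simp
  also have "\<dots> \<le> (LINT v|lborel. norm (indicator {s..t} v *\<^sub>R (h v * g (grid_point s n (grid_index s n v)))))"
    unfolding set_lebesgue_integral_def by (rule integral_norm_bound)
  also have "\<dots> \<le> (LINT v|lborel. B * (indicator {s..t} v *\<^sub>R \<bar>h v\<bar>))"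
  proof (rule integral_mono)
    show "integrable lborel (\<lambda>v. norm (indicator {s..t} v *\<^sub>R (h v * g (grid_point s n (grid_index s n v)))))"
      using int unfolding set_integrable_def by (rule integrable_norm)
    show "integrable lborel (\<lambda>v. B * (indicator {s..t} v *\<^sub>R \<bar>h v\<bar>))"
      using set_integrable_abs[OF h] unfolding set_integrable_def by (rule integrable_mult_right)
    fix v
    show "norm (indicator {s..t} v *\<^sub>R (h v * g (grid_point s n (grid_index s n v)))) \<le>
        B * (indicator {s..t} v *\<^sub>R \<bar>h v\<bar>)"
    proof (cases "v \<in> {s..t}")
      case True
      then have "\<bar>g (grid_point s n (grid_index s n v))\<bar> \<le> B"
        using grid_point_grid_index(1)[of s v n] by (intro assms grid_point_ge) auto
      then show ?thesis
        using True by (simp add: abs_mult mult.commute[of B] mult_left_mono)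
    qed simp
  qed
  also have "\<dots> = B * (LINT v:{s..t}|lborel. \<bar>h v\<bar>)"
    unfolding set_lebesgue_integral_def by (rule integral_mult_right_zero)
  finally show ?thesis .
qed

text \<open>Convergence is asked for almost everywhere, which covers both a continuous path and the
  indicator of a half-line with its single jump.\<close>

lemma grid_sum_tendsto:
  assumes bound: "\<And>r. s \<le> r \<Longrightarrow> r \<le> t \<Longrightarrow> \<bar>g r\<bar> \<le> B"
    and meas: "set_borel_measurable lborel {s..t} (\<lambda>v. h v * g v)"
    and lim: "AE v in lborel. v \<in> {s..t} \<longrightarrow> (\<lambda>n. g (grid_point s n (grid_index s n v))) \<longlonglongrightarrow> g v"
  shows "(\<lambda>n. \<Sum>i\<le>grid_index s n t. cell_integral s t h n i * g (grid_point s n i))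
    \<longlonglongrightarrow> (LINT v:{s..t}|lborel. h v * g v)"
proof -
  have "(\<lambda>n. LINT v:{s..t}|lborel. h v * g (grid_point s n (grid_index s n v)))
      \<longlonglongrightarrow> (LINT v:{s..t}|lborel. h v * g v)"
    unfolding set_lebesgue_integral_def
  proof (rule integral_dominated_convergence[where w="\<lambda>v. B * (indicator {s..t} v *\<^sub>R \<bar>h v\<bar>)"])
    show "(\<lambda>v. indicator {s..t} v *\<^sub>R (h v * g v)) \<in> borel_measurable lborel"
      using meas by (simp add: set_borel_measurable_def)
    show "(\<lambda>v. indicator {s..t} v *\<^sub>R (h v * g (grid_point s n (grid_index s n v)))) \<in> borel_measurable lborel" for n
      using set_integrable_step[of "\<lambda>i. g (grid_point s n i)" n] unfolding set_integrable_def
      by (rule borel_measurable_integrable)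
    show "integrable lborel (\<lambda>v. B * (indicator {s..t} v *\<^sub>R \<bar>h v\<bar>))"
      using set_integrable_abs[OF h] unfolding set_integrable_def by (rule integrable_mult_right)
    show "AE v in lborel. (\<lambda>n. indicator {s..t} v *\<^sub>R (h v * g (grid_point s n (grid_index s n v))))
        \<longlonglongrightarrow> indicator {s..t} v *\<^sub>R (h v * g v)"
      using lim
    proof eventually_elim
      case (elim v)
      then show ?case
        by (cases "v \<in> {s..t}") (auto intro!: tendsto_intros)
    qed
    show "AE v in lborel. norm (indicator {s..t} v *\<^sub>R (h v * g (grid_point s n (grid_index s n v)))) \<le>
        B * (indicator {s..t} v *\<^sub>R \<bar>h v\<bar>)" for n
    proof (rule AE_I2)
      fix v
      show "norm (indicator {s..t} v *\<^sub>R (h v * g (grid_point s n (grid_index s n v)))) \<le>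
          B * (indicator {s..t} v *\<^sub>R \<bar>h v\<bar>)"
      proof (cases "v \<in> {s..t}")
        case True
        then have "\<bar>g (grid_point s n (grid_index s n v))\<bar> \<le> B"
          using grid_point_grid_index(1)[of s v n] by (intro bound grid_point_ge) auto
        then show ?thesis
          using True by (simp add: abs_mult mult.commute[of B] mult_left_mono)
      qed simp
    qed
  qed
  then show ?thesis
    using set_integral_step[of "\<lambda>i. g (grid_point s _ i)"] by simp
qed

end

section \<open>Mean-square limits and Gaussian laws\<close>

text \<open>The nonnegative integral matches the convergence of integrals in
  \<open>has_ito_integral\<close>; the same notion serves for random variables and for integrands on
  \<open>lborel\<close>.\<close>

definition L2_tendsto :: "'a measure \<Rightarrow> (nat \<Rightarrow> 'a \<Rightarrow> real) \<Rightarrow> ('a \<Rightarrow> real) \<Rightarrow> bool" where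
  "L2_tendsto M X Y \<longleftrightarrow> (\<lambda>k. \<integral>\<^sup>+\<omega>. ennreal ((X k \<omega> - Y \<omega>)\<^sup>2) \<partial>M) \<longlonglongrightarrow> 0"

lemma power2_add_le: "((a::real) + b)\<^sup>2 \<le> 2 * a\<^sup>2 + 2 * b\<^sup>2"
  using zero_le_power2[of "a - b"] by (simp add: power2_eq_square algebra_simps)

lemma nn_integral_power2_add_le:
  assumes [measurable]: "U \<in> borel_measurable M" "V \<in> borel_measurable M"
  shows "(\<integral>\<^sup>+\<omega>. ennreal ((U \<omega> + V \<omega>)\<^sup>2) \<partial>M) \<le>
    2 * (\<integral>\<^sup>+\<omega>. ennreal ((U \<omega>)\<^sup>2) \<partial>M) + 2 * (\<integral>\<^sup>+\<omega>. ennreal ((V \<omega>)\<^sup>2) \<partial>M)"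
proof -
  have "ennreal ((U \<omega> + V \<omega>)\<^sup>2) \<le> 2 * ennreal ((U \<omega>)\<^sup>2) + 2 * ennreal ((V \<omega>)\<^sup>2)" for \<omega>
  proof -
    have "ennreal ((U \<omega> + V \<omega>)\<^sup>2) \<le> ennreal (2 * (U \<omega>)\<^sup>2 + 2 * (V \<omega>)\<^sup>2)"
      by (intro ennreal_leI power2_add_le)
    then show ?thesis
      by (simp add: ennreal_plus ennreal_mult)
  qed
  then have "(\<integral>\<^sup>+\<omega>. ennreal ((U \<omega> + V \<omega>)\<^sup>2) \<partial>M) \<le>
      (\<integral>\<^sup>+\<omega>. 2 * ennreal ((U \<omega>)\<^sup>2) + 2 * ennreal ((V \<omega>)\<^sup>2) \<partial>M)"
    by (intro nn_integral_mono)
  also have "\<dots> = 2 * (\<integral>\<^sup>+\<omega>. ennreal ((U \<omega>)\<^sup>2) \<partial>M) + 2 * (\<integral>\<^sup>+\<omega>. ennreal ((V \<omega>)\<^sup>2) \<partial>M)"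
    by (simp add: nn_integral_add nn_integral_cmult)
  finally show ?thesis .
qed

lemma L2_tendsto_add_aux:
  assumes 1: "(\<lambda>k. \<integral>\<^sup>+\<omega>. ennreal ((U k \<omega>)\<^sup>2) \<partial>M) \<longlonglongrightarrow> 0"
    and 2: "(\<lambda>k. \<integral>\<^sup>+\<omega>. ennreal ((V k \<omega>)\<^sup>2) \<partial>M) \<longlonglongrightarrow> 0"
    and [measurable]: "\<And>k. U k \<in> borel_measurable M" "\<And>k. V k \<in> borel_measurable M"
  shows "(\<lambda>k. \<integral>\<^sup>+\<omega>. ennreal ((U k \<omega> + V k \<omega>)\<^sup>2) \<partial>M) \<longlonglongrightarrow> 0"
proof (rule tendsto_sandwich)
  show "(\<lambda>_. 0) \<longlonglongrightarrow> (0::ennreal)"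
    by (rule tendsto_const)
  show "(\<lambda>k. 2 * (\<integral>\<^sup>+\<omega>. ennreal ((U k \<omega>)\<^sup>2) \<partial>M) + 2 * (\<integral>\<^sup>+\<omega>. ennreal ((V k \<omega>)\<^sup>2) \<partial>M)) \<longlonglongrightarrow> 0"
    using tendsto_add[OF ennreal_tendsto_cmult[OF _ 1, of 2] ennreal_tendsto_cmult[OF _ 2, of 2]] by simp
qed (auto intro!: always_eventually nn_integral_power2_add_le)

lemma L2_tendsto_trans:
  assumes "(\<lambda>k. \<integral>\<^sup>+\<omega>. ennreal ((X k \<omega> - Y k \<omega>)\<^sup>2) \<partial>M) \<longlonglongrightarrow> 0" "L2_tendsto M Y Z"
    and [measurable]: "\<And>k. X k \<in> borel_measurable M" "\<And>k. Y k \<in> borel_measurable M" "Z \<in> borel_measurable M"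
  shows "L2_tendsto M X Z"
  using L2_tendsto_add_aux[OF assms(1) assms(2)[unfolded L2_tendsto_def]] by (simp add: L2_tendsto_def)

lemma L2_tendsto_add:
  assumes "L2_tendsto M X Y" "L2_tendsto M X' Y'"
    and [measurable]: "\<And>k. X k \<in> borel_measurable M" "\<And>k. X' k \<in> borel_measurable M"
      "Y \<in> borel_measurable M" "Y' \<in> borel_measurable M"
  shows "L2_tendsto M (\<lambda>k \<omega>. X k \<omega> + X' k \<omega>) (\<lambda>\<omega>. Y \<omega> + Y' \<omega>)"
  using L2_tendsto_add_aux[OF assms(1,2)[unfolded L2_tendsto_def]]
  by (simp add: L2_tendsto_def algebra_simps)

lemma L2_tendsto_cmult:
  assumes "L2_tendsto M X Y"
    and [measurable]: "\<And>k. X k \<in> borel_measurable M" "Y \<in> borel_measurable M"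
  shows "L2_tendsto M (\<lambda>k \<omega>. c * X k \<omega>) (\<lambda>\<omega>. c * Y \<omega>)"
proof -
  have "(\<integral>\<^sup>+\<omega>. ennreal ((c * X k \<omega> - c * Y \<omega>)\<^sup>2) \<partial>M) =
      ennreal (c\<^sup>2) * (\<integral>\<^sup>+\<omega>. ennreal ((X k \<omega> - Y \<omega>)\<^sup>2) \<partial>M)" for k
  proof -
    have "(c * X k \<omega> - c * Y \<omega>)\<^sup>2 = c\<^sup>2 * (X k \<omega> - Y \<omega>)\<^sup>2" for \<omega>
      by (simp add: power2_eq_square algebra_simps)
    then show ?thesis
      by (simp add: ennreal_mult nn_integral_cmult)
  qed
  moreover have "(\<lambda>k. ennreal (c\<^sup>2) * (\<integral>\<^sup>+\<omega>. ennreal ((X k \<omega> - Y \<omega>)\<^sup>2) \<partial>M)) \<longlonglongrightarrow> 0"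
    using ennreal_tendsto_cmult[OF _ assms(1)[unfolded L2_tendsto_def], of "ennreal (c\<^sup>2)"] by simp
  ultimately show ?thesis
    by (simp add: L2_tendsto_def)
qed

text \<open>Young's inequality with weight \<open>e\<close> for the cross term
  \<open>2 * ((a - b) * b)\<close>: the term in \<open>b\<close> is made small through
  \<open>e\<close> before \<open>a - b\<close> tends to zero.\<close>

lemma abs_diff_squares_le:
  fixes a b e :: real
  assumes "0 < e"
  shows "\<bar>a\<^sup>2 - b\<^sup>2\<bar> \<le> (1 + 1 / e) * (a - b)\<^sup>2 + e * b\<^sup>2"
proof -
  have "0 \<le> ((a - b) - e * b)\<^sup>2 / e" "0 \<le> ((a - b) + e * b)\<^sup>2 / e"
    using assms by simp_all
  then have "2 * ((a - b) * b) \<le> (a - b)\<^sup>2 / e + e * b\<^sup>2" "- 2 * ((a - b) * b) \<le> (a - b)\<^sup>2 / e + e * b\<^sup>2"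
    using assms by (simp_all add: field_simps power2_eq_square)
  moreover have "a\<^sup>2 - b\<^sup>2 = (a - b)\<^sup>2 + 2 * ((a - b) * b)"
    by (simp add: power2_eq_square algebra_simps)
  moreover have "(1 + 1 / e) * (a - b)\<^sup>2 = (a - b)\<^sup>2 + (a - b)\<^sup>2 / e"
    by (simp add: field_simps)
  ultimately show ?thesis
    using zero_le_power2[of "a - b"] by linarith
qed

text \<open>Applied to integrands on \<open>lborel\<close>, this gives the convergence of the
  variances of step sums.\<close>

lemma L2_tendsto_integral_power2:
  assumes lim: "L2_tendsto M X Y"
    and X: "\<And>k. integrable M (\<lambda>\<omega>. (X k \<omega>)\<^sup>2)" and Y: "integrable M (\<lambda>\<omega>. (Y \<omega>)\<^sup>2)"
    and [measurable]: "\<And>k. X k \<in> borel_measurable M" "Y \<in> borel_measurable M"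
  shows "(\<lambda>k. \<integral>\<omega>. (X k \<omega>)\<^sup>2 \<partial>M) \<longlonglongrightarrow> (\<integral>\<omega>. (Y \<omega>)\<^sup>2 \<partial>M)"
proof -
  have int: "integrable M (\<lambda>\<omega>. (X k \<omega> - Y \<omega>)\<^sup>2)" for k
  proof (rule Bochner_Integration.integrable_bound)
    show "integrable M (\<lambda>\<omega>. 2 * (X k \<omega>)\<^sup>2 + 2 * (Y \<omega>)\<^sup>2)"
      using X Y by simp
    show "AE \<omega> in M. norm ((X k \<omega> - Y \<omega>)\<^sup>2) \<le> norm (2 * (X k \<omega>)\<^sup>2 + 2 * (Y \<omega>)\<^sup>2)"
      using power2_add_le[of "X k _" "- Y _"] by (intro AE_I2) simp
  qed measurable
  define E where "E k = (\<integral>\<omega>. (X k \<omega> - Y \<omega>)\<^sup>2 \<partial>M)" for k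
  have "(\<integral>\<^sup>+\<omega>. ennreal ((X k \<omega> - Y \<omega>)\<^sup>2) \<partial>M) = ennreal (E k)" for k
    unfolding E_def by (rule nn_integral_eq_integral[OF int]) simp
  then have "(\<lambda>k. ennreal (E k)) \<longlonglongrightarrow> ennreal 0"
    using lim by (simp add: L2_tendsto_def)
  then have E: "E \<longlonglongrightarrow> 0"
    by (rule tendsto_ennrealD) (auto simp: E_def intro!: always_eventually)
  let ?I = "\<integral>\<omega>. (Y \<omega>)\<^sup>2 \<partial>M"
  have I: "0 \<le> ?I" by simp
  have bound: "\<bar>(\<integral>\<omega>. (X k \<omega>)\<^sup>2 \<partial>M) - ?I\<bar> \<le> (1 + 1 / e) * E k + e * ?I" if "0 < e" for e k
  proof -
    have "\<bar>(\<integral>\<omega>. (X k \<omega>)\<^sup>2 \<partial>M) - ?I\<bar> = norm (\<integral>\<omega>. (X k \<omega>)\<^sup>2 - (Y \<omega>)\<^sup>2 \<partial>M)"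
      using X Y by simp
    also have "\<dots> \<le> (\<integral>\<omega>. norm ((X k \<omega>)\<^sup>2 - (Y \<omega>)\<^sup>2) \<partial>M)"
      by (rule integral_norm_bound)
    also have "\<dots> \<le> (\<integral>\<omega>. (1 + 1 / e) * (X k \<omega> - Y \<omega>)\<^sup>2 + e * (Y \<omega>)\<^sup>2 \<partial>M)"
      using X Y int abs_diff_squares_le[OF that] by (intro integral_mono) auto
    also have "\<dots> = (1 + 1 / e) * E k + e * ?I"
      using int Y by (simp add: E_def)
    finally show ?thesis .
  qed
  show ?thesis
  proof (rule LIMSEQ_I)
    fix r :: real assume r: "0 < r"
    \<comment> \<open>The denominator contains \<open>J + 1\<close> so that \<open>J = 0\<close> is
      covered and the inequality is strict.\<close>
    have "\<exists>e>0. e * J < r / 2" if "0 \<le> J" for J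
      using that r by (intro exI[of _ "r / (2 * (J + 1))"]) (simp add: field_simps)
    from this[OF I] obtain e where e: "0 < e" and "e * ?I < r / 2"
      by blast
    have "(\<lambda>k. (1 + 1 / e) * E k) \<longlonglongrightarrow> (1 + 1 / e) * 0"
      by (intro tendsto_intros E)
    then have "\<forall>\<^sub>F k in sequentially. (1 + 1 / e) * E k < r / 2"
      by (rule order_tendstoD(2)) (use r in simp)
    then obtain N where N: "\<And>k. N \<le> k \<Longrightarrow> (1 + 1 / e) * E k < r / 2"
      by (auto simp: eventually_sequentially)
    have "norm ((\<integral>\<omega>. (X k \<omega>)\<^sup>2 \<partial>M) - ?I) < r" if "N \<le> k" for k
    proof -
      have "norm ((\<integral>\<omega>. (X k \<omega>)\<^sup>2 \<partial>M) - ?I) \<le> (1 + 1 / e) * E k + e * ?I"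
        using bound[OF e, of k] unfolding real_norm_def .
      also have "\<dots> < r / 2 + r / 2"
        by (intro add_strict_mono N that \<open>e * ?I < r / 2\<close>)
      finally show ?thesis
        by simp
    qed
    then show "\<exists>N. \<forall>k\<ge>N. norm ((\<integral>\<omega>. (X k \<omega>)\<^sup>2 \<partial>M) - ?I) < r"
      by blast
  qed
qed

section \<open>Characteristic functions and exponential moments\<close>

lemma norm_iexp_diff_le: "norm (iexp a - iexp b) \<le> \<bar>a - b\<bar>"
proof -
  have "iexp a - iexp b = iexp b * (iexp (a - b) - 1)"
    by (simp add: algebra_simps flip: exp_add)
  then have "norm (iexp a - iexp b) = norm (iexp (a - b) - 1)"
    by (simp add: norm_mult)
  also have "\<dots> \<le> \<bar>a - b\<bar>"
    using iexp_approx1[of "a - b" 0] by simp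
  finally show ?thesis .
qed

lemma (in prob_space) integrable_indicator_iexp:
  assumes [measurable]: "X \<in> borel_measurable M" "A \<in> events"
  shows "integrable M (\<lambda>\<omega>. indicator A \<omega> * iexp (\<theta> * X \<omega>))"
  by (rule integrable_const_bound[where B=1]) (auto simp: norm_mult indicator_def)

text \<open>As \<open>iexp\<close> is 1-Lipschitz, the integrals differ by at most the first
  absolute moment of \<open>\<theta> * X k - \<theta> * Y\<close>. Cauchy-Schwarz against the
  constant 1, of total mass 1, bounds its square by the mean-square distance.\<close>

lemma (in prob_space) L2_tendsto_iexp:
  assumes lim: "L2_tendsto M X Y" and A[measurable]: "A \<in> events"
    and [measurable]: "\<And>k. X k \<in> borel_measurable M" "Y \<in> borel_measurable M"
  shows "(\<lambda>k. \<integral>\<omega>. indicator A \<omega> * iexp (\<theta> * X k \<omega>) \<partial>M) \<longlonglongrightarrow> (\<integral>\<omega>. indicator A \<omega> * iexp (\<theta> * Y \<omega>) \<partial>M)"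
proof -
  define d where "d k = norm ((\<integral>\<omega>. indicator A \<omega> * iexp (\<theta> * X k \<omega>) \<partial>M) -
    (\<integral>\<omega>. indicator A \<omega> * iexp (\<theta> * Y \<omega>) \<partial>M))" for k
  have d_le: "ennreal ((d k)\<^sup>2) \<le> (\<integral>\<^sup>+\<omega>. ennreal ((\<theta> * X k \<omega> - \<theta> * Y \<omega>)\<^sup>2) \<partial>M)" for k
  proof -
    let ?f = "\<lambda>\<omega>. indicator A \<omega> * iexp (\<theta> * X k \<omega>) - indicator A \<omega> * iexp (\<theta> * Y \<omega>)"
    have int_XY: "integrable M (\<lambda>\<omega>. indicator A \<omega> * iexp (\<theta> * X k \<omega>))"
        "integrable M (\<lambda>\<omega>. indicator A \<omega> * iexp (\<theta> * Y \<omega>))"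
      by (rule integrable_indicator_iexp; measurable)+
    have int: "integrable M ?f"
      using int_XY by (rule Bochner_Integration.integrable_diff)
    have le: "norm (?f \<omega>) \<le> \<bar>\<theta> * X k \<omega> - \<theta> * Y \<omega>\<bar>" for \<omega>
      using norm_iexp_diff_le[of "\<theta> * X k \<omega>" "\<theta> * Y \<omega>"] by (simp add: indicator_def)
    have "ennreal (d k) = ennreal (norm (\<integral>\<omega>. ?f \<omega> \<partial>M))"
      unfolding d_def Bochner_Integration.integral_diff[OF int_XY] ..
    also have "\<dots> \<le> (\<integral>\<^sup>+\<omega>. ennreal (norm (?f \<omega>)) \<partial>M)"
      by (rule integral_norm_bound_ennreal[OF int])
    also have "\<dots> \<le> (\<integral>\<^sup>+\<omega>. ennreal \<bar>\<theta> * X k \<omega> - \<theta> * Y \<omega>\<bar> * 1 \<partial>M)"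
      using le by (intro nn_integral_mono) (simp add: ennreal_leI)
    finally have "(ennreal (d k))\<^sup>2 \<le> (\<integral>\<^sup>+\<omega>. ennreal \<bar>\<theta> * X k \<omega> - \<theta> * Y \<omega>\<bar> * 1 \<partial>M)\<^sup>2"
      by (intro power_mono) auto
    also have "\<dots> \<le> (\<integral>\<^sup>+\<omega>. (ennreal \<bar>\<theta> * X k \<omega> - \<theta> * Y \<omega>\<bar>)\<^sup>2 \<partial>M) * (\<integral>\<^sup>+\<omega>. 1\<^sup>2 \<partial>M)"
      by (rule Cauchy_Schwarz_nn_integral) auto
    finally show ?thesis
      by (simp add: ennreal_power emeasure_space_1 d_def)
  qed
  have d_lim: "(\<lambda>k. \<integral>\<^sup>+\<omega>. ennreal ((\<theta> * X k \<omega> - \<theta> * Y \<omega>)\<^sup>2) \<partial>M) \<longlonglongrightarrow> 0"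
    using L2_tendsto_cmult[OF lim, of \<theta>] by (simp add: L2_tendsto_def)
  have "(\<lambda>k. ennreal ((d k)\<^sup>2)) \<longlonglongrightarrow> 0"
    by (rule tendsto_sandwich[OF _ _ tendsto_const d_lim]) (auto intro!: always_eventually d_le)
  then have "(\<lambda>k. (d k)\<^sup>2) \<longlonglongrightarrow> 0"
    by (simp flip: ennreal_0 add: tendsto_ennreal_iff)
  moreover have "0 \<le> d k" for k
    by (simp add: d_def)
  ultimately have "d \<longlonglongrightarrow> 0"
    using tendsto_real_sqrt[of "\<lambda>k. (d k)\<^sup>2" 0] by simp
  then show ?thesis
    unfolding d_def by (subst LIM_zero_iff[symmetric]) (simp add: tendsto_norm_zero_iff)
qed

lemma nn_integral_std_normal_exp:
  "(\<integral>\<^sup>+z. ennreal (exp (k * z)) \<partial>std_normal_distribution) = ennreal (exp (k\<^sup>2 / 2))"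
proof -
  \<comment> \<open>Completing the square: tilting the standard density by
    \<open>exp (k * z)\<close> moves its mean to \<open>k\<close>.\<close>
  have eq: "std_normal_density z * exp (k * z) = exp (k\<^sup>2 / 2) * normal_density k 1 z" for z
    by (simp add: normal_density_def power2_eq_square field_simps flip: exp_add)
  have "(\<integral>\<^sup>+z. ennreal (exp (k * z)) \<partial>std_normal_distribution) =
      (\<integral>\<^sup>+z. ennreal (std_normal_density z) * ennreal (exp (k * z)) \<partial>lborel)"
    by (subst nn_integral_density) auto
  also have "\<dots> = (\<integral>\<^sup>+z. ennreal (exp (k\<^sup>2 / 2)) * ennreal (normal_density k 1 z) \<partial>lborel)"
    by (simp add: eq flip: ennreal_mult)
  also have "\<dots> = ennreal (exp (k\<^sup>2 / 2)) * (\<integral>\<^sup>+z. ennreal (normal_density k 1 z) \<partial>lborel)"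
    by (rule nn_integral_cmult) simp
  also have "(\<integral>\<^sup>+z. ennreal (normal_density k 1 z) \<partial>lborel) = 1"
    by (subst nn_integral_eq_integral) (auto simp: integral_normal_density)
  finally show ?thesis by simp
qed

text \<open>The Gaussian law on \<open>A\<close> is the image of the standard one under \<open>z \<mapsto> z sqrt V\<close>, which also
  covers the degenerate case \<open>V = 0\<close>.\<close>

lemma (in prob_space) gaussian_exp_moment_on:
  assumes [measurable]: "X \<in> borel_measurable M" "A \<in> events" and V: "0 \<le> V"
    and char: "\<And>\<theta>. (\<integral>\<omega>. indicator A \<omega> * iexp (\<theta> * X \<omega>) \<partial>M) =
      complex_of_real (prob A * exp (- (\<theta>\<^sup>2 * V) / 2))"
  shows "(\<integral>\<^sup>+\<omega>\<in>A. ennreal (exp (c * X \<omega>)) \<partial>M) = ennreal (exp (c\<^sup>2 * V / 2)) * emeasure M A"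
proof (cases "prob A = 0")
  case True
  then have "A \<in> null_sets M"
    by (auto simp: emeasure_eq_measure)
  then show ?thesis
    using True by (simp add: nn_integral_null_set emeasure_eq_measure)
next
  case False
  then have pos: "0 < prob A"
    by (simp add: zero_less_measure_iff)
  \<comment> \<open>Conditioning on \<open>A\<close> turns the integral restricted to
    \<open>A\<close> into the characteristic function of a probability law, to which uniqueness
    applies.\<close>
  define M' where "M' = uniform_measure M A"
  have M': "prob_space M'"
    unfolding M'_def by (rule prob_space_uniform_measure) (use pos in \<open>auto simp: emeasure_eq_measure\<close>)
  interpret M': prob_space M' by (fact M')
  have [measurable_cong]: "sets M' = sets M"
    by (simp add: M'_def)
  define D where "D = distr std_normal_distribution borel (\<lambda>z. sqrt V * z)"
  interpret N: real_distribution std_normal_distribution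
    by (rule real_dist_normal_dist)
  have D: "real_distribution D"
    unfolding D_def by (rule N.real_distribution_distr) simp
  have dens: "M' = density M (\<lambda>\<omega>. ennreal (indicator A \<omega> / prob A))"
    unfolding M'_def uniform_measure_def
    by (rule density_cong) (auto simp: emeasure_eq_measure indicator_def divide_ennreal pos ennreal_1[symmetric] simp del: ennreal_1)
  have "distr M' borel X = D"
  proof (rule Levy_uniqueness)
    show "real_distribution (distr M' borel X)"
      by (rule M'.real_distribution_distr) simp
    show "char (distr M' borel X) = char D"
    proof
      fix \<theta>
      have "char (distr M' borel X) \<theta> = (\<integral>\<omega>. iexp (\<theta> * X \<omega>) \<partial>M')"
        unfolding char_def by (subst integral_distr) auto
      also have "\<dots> = (\<integral>\<omega>. (indicator A \<omega> / prob A) *\<^sub>R iexp (\<theta> * X \<omega>) \<partial>M)"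
        unfolding dens by (subst integral_density) auto
      also have "\<dots> = (\<integral>\<omega>. (1 / prob A) *\<^sub>R (indicator A \<omega> * iexp (\<theta> * X \<omega>)) \<partial>M)"
        by (intro Bochner_Integration.integral_cong) (auto simp: indicator_def)
      also have "\<dots> = (1 / prob A) *\<^sub>R (\<integral>\<omega>. indicator A \<omega> * iexp (\<theta> * X \<omega>) \<partial>M)"
        by (rule integral_scaleR_right)
      also have "\<dots> = complex_of_real (exp (- (\<theta>\<^sup>2 * V) / 2))"
        using pos unfolding char by (simp add: scaleR_conv_of_real)
      also have "\<dots> = char std_normal_distribution (\<theta> * sqrt V)"
        using V by (simp add: char_std_normal_distribution power_mult_distrib)
      also have "\<dots> = char D \<theta>"
        unfolding char_def D_def by (subst integral_distr) (auto simp: mult.assoc)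
      finally show "char (distr M' borel X) \<theta> = char D \<theta>" .
    qed
  qed (rule D)
  \<comment> \<open>Equality of laws extends to the unbounded function \<open>exp (c * y)\<close>,
    which the characteristic function does not reach directly.\<close>
  then have "(\<integral>\<^sup>+y. ennreal (exp (c * y)) \<partial>distr M' borel X) = (\<integral>\<^sup>+y. ennreal (exp (c * y)) \<partial>D)"
    by simp
  then have "(\<integral>\<^sup>+\<omega>. ennreal (exp (c * X \<omega>)) \<partial>M') = (\<integral>\<^sup>+z. ennreal (exp (c * sqrt V * z)) \<partial>std_normal_distribution)"
    unfolding D_def by (simp add: nn_integral_distr mult.assoc)
  also have "\<dots> = ennreal (exp (c\<^sup>2 * V / 2))"
    using V by (simp add: nn_integral_std_normal_exp power_mult_distrib)
  also have "(\<integral>\<^sup>+\<omega>. ennreal (exp (c * X \<omega>)) \<partial>M') = (\<integral>\<^sup>+\<omega>\<in>A. ennreal (exp (c * X \<omega>)) \<partial>M) / emeasure M A"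
    unfolding M'_def by (subst nn_integral_uniform_measure) (use pos in \<open>auto simp: emeasure_eq_measure\<close>)
  finally have "(\<integral>\<^sup>+\<omega>\<in>A. ennreal (exp (c * X \<omega>)) \<partial>M) / emeasure M A * emeasure M A =
      ennreal (exp (c\<^sup>2 * V / 2)) * emeasure M A"
    by simp
  then show ?thesis
    using pos by (simp add: ennreal_divide_times ennreal_divide_self emeasure_eq_measure)
qed

section \<open>Wiener integrals\<close>

text \<open>A pair \<open>(d, r)\<close> stands for the integrand \<open>d 1\<^bsub>(s, r]\<^esub>\<close>. The points \<open>r\<close> of a list are neither ordered nor
  distinct, so that lists belonging to different partitions add up by concatenation.\<close>

definition step_fun :: "real \<Rightarrow> (real \<times> real) list \<Rightarrow> real \<Rightarrow> real" where
  "step_fun s xs u = (\<Sum>(d, r)\<leftarrow>xs. d * indicator {s<..r} u)"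

definition step_sum :: "(real \<Rightarrow> 'a \<Rightarrow> real) \<Rightarrow> real \<Rightarrow> (real \<times> real) list \<Rightarrow> 'a \<Rightarrow> real" where
  "step_sum W s xs \<omega> = (\<Sum>(d, r)\<leftarrow>xs. d * (W r \<omega> - W s \<omega>))"

lemma step_fun_simps [simp]:
  "step_fun s [] u = 0"
  "step_fun s ((d, r) # xs) u = d * indicator {s<..r} u + step_fun s xs u"
  "step_fun s (xs @ ys) u = step_fun s xs u + step_fun s ys u"
  by (simp_all add: step_fun_def)

lemma step_sum_simps [simp]:
  "step_sum W s [] \<omega> = 0"
  "step_sum W s ((d, r) # xs) \<omega> = d * (W r \<omega> - W s \<omega>) + step_sum W s xs \<omega>"
  "step_sum W s (xs @ ys) \<omega> = step_sum W s xs \<omega> + step_sum W s ys \<omega>"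
  by (simp_all add: step_sum_def)

lemma step_fun_measurable [measurable]: "step_fun s xs \<in> borel_measurable borel"
proof (induction xs)
  case (Cons p xs)
  have "step_fun s (p # xs) = (\<lambda>u. fst p * indicator {s<..snd p} u + step_fun s xs u)"
    by (cases p) (auto simp: fun_eq_iff)
  with Cons show ?case by simp
qed (simp add: step_fun_def[abs_def])

lemma step_fun_scale: "step_fun s (map (\<lambda>(d, r). (c * d, r)) xs) u = c * step_fun s xs u"
  by (induction xs) (auto simp: distrib_left)

lemma step_sum_scale: "step_sum W s (map (\<lambda>(d, r). (c * d, r)) xs) \<omega> = c * step_sum W s xs \<omega>"
  by (induction xs) (auto simp: distrib_left)

lemma step_fun_eq_0:
  assumes "\<And>p. p \<in> set xs \<Longrightarrow> snd p \<le> r" "r < u"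
  shows "step_fun s xs u = 0"
  using assms
proof (induction xs)
  case (Cons p xs)
  from Cons.prems(1)[of p] Cons.prems(2) have "\<not> u \<le> snd p" by simp
  with Cons show ?case by (cases p) simp
qed simp

lemma step_fun_concat: "step_fun s (concat (map xs is)) u = (\<Sum>i\<leftarrow>is. step_fun s (xs i) u)"
  by (induction "is") auto

lemma step_sum_concat: "step_sum W s (concat (map xs is)) \<omega> = (\<Sum>i\<leftarrow>is. step_sum W s (xs i) \<omega>)"
  by (induction "is") auto

text \<open>Lets a list be sorted before the law of its step sum is computed.\<close>

lemma step_fun_mset_cong: "mset xs = mset ys \<Longrightarrow> step_fun s xs u = step_fun s ys u"
  unfolding step_fun_def by (simp flip: sum_mset_sum_list)

lemma step_sum_mset_cong: "mset xs = mset ys \<Longrightarrow> step_sum W s xs \<omega> = step_sum W s ys \<omega>"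
  unfolding step_sum_def by (simp flip: sum_mset_sum_list)

section \<open>Brownian increments and the law of step sums\<close>

context brownian_motion
begin

lemma subalgebra_F: "subalgebra M (F u)"
  using space_F sets_F_subset by (simp add: subalgebra_def)

lemma measurable_F: "f \<in> measurable (F u) N \<Longrightarrow> f \<in> measurable M N"
  by (rule measurable_from_subalg[OF subalgebra_F])

lemma measurable_F_mono:
  assumes "f \<in> measurable (F u) N" "u \<le> v"
  shows "f \<in> measurable (F v) N"
proof (rule measurable_from_subalg[OF _ assms(1)])
  show "subalgebra (F v) (F u)"
    using sets_F_mono[OF assms(2)] by (simp add: subalgebra_def space_F)
qed

lemma W_measurable: "0 \<le> r \<Longrightarrow> W r \<in> borel_measurable M"
  using adapted measurable_F by blast

lemma W_measurable_F: "0 \<le> r \<Longrightarrow> r \<le> u \<Longrightarrow> W r \<in> borel_measurable (F u)"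
  using adapted measurable_F_mono by blast

text \<open>Turns \<open>increment_indep\<close>, a statement on events, into independence of random
  variables. The function \<open>f\<close> stands for a complex exponential, the identity or a
  square.\<close>

lemma increment_indep_var:
  fixes X :: "'a \<Rightarrow> 'b::topological_space" and f :: "real \<Rightarrow> 'b"
  assumes uv: "0 \<le> u" "u < v" and X: "X \<in> borel_measurable (F u)"
    and [measurable]: "f \<in> borel_measurable borel"
  shows "indep_var borel X borel (\<lambda>\<omega>. f (W v \<omega> - W u \<omega>))"
  unfolding indep_var_eq
proof (intro conjI)
  have [measurable]: "W u \<in> borel_measurable M" "W v \<in> borel_measurable M"
    using uv by (auto intro: W_measurable)
  show "random_variable borel X"
    using X by (rule measurable_F)
  show "random_variable borel (\<lambda>\<omega>. f (W v \<omega> - W u \<omega>))"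
    by measurable
  let ?D = "\<lambda>\<omega>. W v \<omega> - W u \<omega>"
  let ?DS = "{?D -` A \<inter> space M |A. A \<in> sets borel}"
  have 1: "sigma_sets (space M) {X -` A \<inter> space M |A. A \<in> sets borel} \<subseteq> sets (F u)"
    using sets.sigma_sets_subset[of "{X -` A \<inter> space M |A. A \<in> sets borel}" "F u"]
      measurable_sets[OF X] by (auto simp: space_F)
  \<comment> \<open>The preimages under \<open>?D\<close> already form a sigma-algebra, so whatever
    a subfamily generates stays among them.\<close>
  have 2: "sigma_sets (space M) {(\<lambda>\<omega>. f (?D \<omega>)) -` A \<inter> space M |A. A \<in> sets borel} \<subseteq> ?DS"
  proof -
    have DS: "?DS = sets (vimage_algebra (space M) ?D borel)"
      by (rule sets_vimage_algebra2[symmetric]) auto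
    have "(\<lambda>\<omega>. f (?D \<omega>)) -` A \<inter> space M \<in> ?DS" if "A \<in> sets borel" for A
    proof -
      have "f -` A \<in> sets borel"
        using measurable_sets_borel[of f borel A] that by simp
      moreover have "(\<lambda>\<omega>. f (?D \<omega>)) -` A = ?D -` (f -` A)"
        by auto
      ultimately show ?thesis by auto
    qed
    then have "{(\<lambda>\<omega>. f (?D \<omega>)) -` A \<inter> space M |A. A \<in> sets borel} \<subseteq>
        sets (vimage_algebra (space M) ?D borel)"
      unfolding DS by blast
    from sets.sigma_sets_subset[OF this] show ?thesis
      unfolding DS by simp
  qed
  show "indep_set (sigma_sets (space M) {X -` A \<inter> space M |A. A \<in> sets borel})
      (sigma_sets (space M) {(\<lambda>\<omega>. f (?D \<omega>)) -` A \<inter> space M |A. A \<in> sets borel})"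
    (is "indep_set ?A ?B")
  proof -
    note indep = increment_indep[OF uv, unfolded indep_sets2_eq]
    show ?thesis
      unfolding indep_sets2_eq
    proof (intro conjI ballI)
      show "?A \<subseteq> events" "?B \<subseteq> events"
        using indep 1 2 by (meson order_trans)+
      fix a b assume "a \<in> ?A" "b \<in> ?B"
      then have "a \<in> sets (F u)" "b \<in> ?DS"
        using 1 2 by (meson subsetD)+
      then show "prob (a \<inter> b) = prob a * prob b"
        using indep by (meson bspec)
    qed
  qed
qed

lemma
  assumes uv: "0 \<le> u" "u < v"
  shows increment_char: "(\<integral>\<omega>. iexp (\<theta> * (W v \<omega> - W u \<omega>)) \<partial>M) = complex_of_real (exp (- (\<theta>\<^sup>2 * (v - u)) / 2))"
    and increment_integrable: "integrable M (\<lambda>\<omega>. W v \<omega> - W u \<omega>)"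
    and increment_expectation: "(\<integral>\<omega>. W v \<omega> - W u \<omega> \<partial>M) = 0"
    and increment_integrable_power2: "integrable M (\<lambda>\<omega>. (W v \<omega> - W u \<omega>)\<^sup>2)"
    and increment_variance: "(\<integral>\<omega>. (W v \<omega> - W u \<omega>)\<^sup>2 \<partial>M) = v - u"
proof -
  let ?D = "\<lambda>\<omega>. W v \<omega> - W u \<omega>"
  have [measurable]: "W u \<in> borel_measurable M" "W v \<in> borel_measurable M"
    using uv by (auto intro: W_measurable)
  have pos: "0 < sqrt (v - u)" using uv by simp
  have D: "distributed M lborel ?D (normal_density 0 (sqrt (v - u)))"
    using uv by (rule increment_distributed)
  have "distributed M lborel (\<lambda>\<omega>. ?D \<omega> / sqrt (v - u)) std_normal_density"
    using D normal_standard_normal_convert[OF pos, of ?D 0] by simp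
  then have std: "distr M lborel (\<lambda>\<omega>. ?D \<omega> / sqrt (v - u)) = std_normal_distribution"
    by (rule distributed_distr_eq_density)
  have "complex_of_real (exp (- (\<theta>\<^sup>2 * (v - u)) / 2)) = char std_normal_distribution (\<theta> * sqrt (v - u))"
    using uv by (simp add: char_std_normal_distribution power_mult_distrib)
  also have "\<dots> = (\<integral>\<omega>. iexp (\<theta> * sqrt (v - u) * (?D \<omega> / sqrt (v - u))) \<partial>M)"
    unfolding char_def std[symmetric] by (subst integral_distr) auto
  also have "\<dots> = (\<integral>\<omega>. iexp (\<theta> * ?D \<omega>) \<partial>M)"
    using pos by (intro Bochner_Integration.integral_cong) auto
  finally show "(\<integral>\<omega>. iexp (\<theta> * ?D \<omega>) \<partial>M) = complex_of_real (exp (- (\<theta>\<^sup>2 * (v - u)) / 2))" ..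
  have i1: "integrable lborel (\<lambda>x. normal_density 0 (sqrt (v - u)) x * x)"
    using integrable_normal_moment[OF pos, of 0 1] by simp
  have i2: "integrable lborel (\<lambda>x. normal_density 0 (sqrt (v - u)) x * x\<^sup>2)"
    using integrable_normal_moment[OF pos, of 0 2] by simp
  show "integrable M ?D"
    using distributed_integrable[OF D, of "\<lambda>x. x"] i1 by simp
  show "integrable M (\<lambda>\<omega>. (?D \<omega>)\<^sup>2)"
    using distributed_integrable[OF D, of "\<lambda>x. x\<^sup>2"] i2 by simp
  show "(\<integral>\<omega>. ?D \<omega> \<partial>M) = 0"
    using distributed_integral[OF D, of "\<lambda>x. x"] integral_normal_moment_nz_1[OF pos, of 0] by simp
  show "(\<integral>\<omega>. (?D \<omega>)\<^sup>2 \<partial>M) = v - u"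
    using distributed_integral[OF D, of "\<lambda>x. x\<^sup>2"] integral_normal_moment_even[OF pos, of 0 1] uv by simp
qed

text \<open>The factor with \<open>A\<close> and \<open>S\<close> is known at time \<open>u\<close>,
  hence independent of the increment, and the expectation splits. The case \<open>u = v\<close>
  occurs because endpoints in a list may coincide.\<close>

lemma char_add_increment:
  assumes "0 \<le> u" "u \<le> v" and S: "S \<in> borel_measurable (F u)" and A: "A \<in> sets (F u)"
  shows "(\<integral>\<omega>. indicator A \<omega> * iexp (\<theta> * (S \<omega> + d * (W v \<omega> - W u \<omega>))) \<partial>M) =
    (\<integral>\<omega>. indicator A \<omega> * iexp (\<theta> * S \<omega>) \<partial>M) * exp (- (\<theta>\<^sup>2 * (d\<^sup>2 * (v - u))) / 2)"
proof (cases "u = v")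
  case False
  with assms have uv: "u < v" by simp
  have [measurable]: "W u \<in> borel_measurable M" "W v \<in> borel_measurable M"
    using assms by (auto intro: W_measurable)
  let ?X = "\<lambda>\<omega>. indicator A \<omega> * iexp (\<theta> * S \<omega>)"
  let ?f = "\<lambda>y. iexp (\<theta> * (d * y))"
  have "indep_var borel ?X borel (\<lambda>\<omega>. ?f (W v \<omega> - W u \<omega>))"
    using assms(1) uv
  proof (rule increment_indep_var)
    show "?X \<in> borel_measurable (F u)"
      using S A by measurable
  qed measurable
  moreover have "integrable M ?X"
    using measurable_F[OF S] A sets_F_subset by (intro integrable_indicator_iexp) auto
  moreover have "integrable M (\<lambda>\<omega>. ?f (W v \<omega> - W u \<omega>))"
    by (rule integrable_const_bound[where B=1]) auto
  ultimately have "(\<integral>\<omega>. ?X \<omega> * ?f (W v \<omega> - W u \<omega>) \<partial>M) =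
      (\<integral>\<omega>. ?X \<omega> \<partial>M) * (\<integral>\<omega>. ?f (W v \<omega> - W u \<omega>) \<partial>M)"
    by (rule indep_var_lebesgue_integral)
  also have "(\<integral>\<omega>. ?f (W v \<omega> - W u \<omega>) \<partial>M) = exp (- (\<theta>\<^sup>2 * (d\<^sup>2 * (v - u))) / 2)"
    using increment_char[OF assms(1) uv, of "\<theta> * d"] by (simp add: power_mult_distrib mult.assoc)
  also have "(\<integral>\<omega>. ?X \<omega> * ?f (W v \<omega> - W u \<omega>) \<partial>M) =
      (\<integral>\<omega>. indicator A \<omega> * iexp (\<theta> * (S \<omega> + d * (W v \<omega> - W u \<omega>))) \<partial>M)"
    by (intro Bochner_Integration.integral_cong) (simp_all add: distrib_left exp_add mult.assoc)
  finally show ?thesis .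
qed simp

lemma step_sum_measurable_F:
  assumes "0 \<le> s" "\<And>p. p \<in> set xs \<Longrightarrow> s \<le> snd p" "\<And>p. p \<in> set xs \<Longrightarrow> snd p \<le> r" "s \<le> r"
  shows "step_sum W s xs \<in> borel_measurable (F r)"
  using assms(2,3)
proof (induction xs)
  case (Cons p xs)
  have [measurable]: "W (snd p) \<in> borel_measurable (F r)" "W s \<in> borel_measurable (F r)"
    using Cons.prems[of p] assms by (auto intro!: W_measurable_F)
  have [measurable]: "step_sum W s xs \<in> borel_measurable (F r)"
    using Cons by simp
  have "step_sum W s (p # xs) = (\<lambda>\<omega>. fst p * (W (snd p) \<omega> - W s \<omega>) + step_sum W s xs \<omega>)"
    by (cases p) (auto simp: fun_eq_iff)
  then show ?case by simp
qed (simp add: step_sum_def[abs_def])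

lemma step_sum_measurable:
  assumes "0 \<le> s" "\<And>p. p \<in> set xs \<Longrightarrow> s \<le> snd p"
  shows "step_sum W s xs \<in> borel_measurable M"
proof (rule measurable_F[OF step_sum_measurable_F[OF assms]])
  \<comment> \<open>At the largest endpoint the whole sum is known; inserting \<open>s\<close> keeps
    the maximum defined for the empty list.\<close>
  show "s \<le> Max (insert s (snd ` set xs))" "\<And>p. p \<in> set xs \<Longrightarrow> snd p \<le> Max (insert s (snd ` set xs))"
    by (auto intro!: Max_ge)
qed

text \<open>Endpoints decrease along the list, so the head carries the last increment. Splitting it
  off leaves a sum known at an earlier time \<open>r\<close>, and the Gaussian factor from
  \<open>char_add_increment\<close> accounts for the part of the squared step function on
  \<open>(r, m]\<close>.\<close>

lemma step_sum_char_sorted: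
  assumes "0 \<le> s" and A: "A \<in> sets (F s)"
    and "sorted_wrt (\<lambda>p q. snd q \<le> snd p) xs" "\<And>p. p \<in> set xs \<Longrightarrow> s \<le> snd p"
  shows "integrable lborel (\<lambda>u. (step_fun s xs u)\<^sup>2) \<and>
    (\<integral>\<omega>. indicator A \<omega> * iexp (\<theta> * step_sum W s xs \<omega>) \<partial>M) =
      complex_of_real (prob A * exp (- (\<theta>\<^sup>2 * (\<integral>u. (step_fun s xs u)\<^sup>2 \<partial>lborel)) / 2))"
  using assms(3,4)
\<comment> \<open>The induction is on the length because the remaining list is a modified
  tail.\<close>
proof (induction "length xs" arbitrary: xs)
  case 0
  have [measurable]: "A \<in> events" using A sets_F_subset by auto
  have "(\<integral>\<omega>. indicator A \<omega> \<partial>M) = (\<integral>\<omega>. complex_of_real (indicator A \<omega>) \<partial>M)"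
    by (intro Bochner_Integration.integral_cong) (auto simp: indicator_def)
  then show ?case using 0 by simp
next
  case (Suc n)
  obtain d m ys where xs: "xs = (d, m) # ys"
    using Suc.hyps(2) by (cases xs) auto
  obtain r zs where zs: "length zs = n" "sorted_wrt (\<lambda>p q. snd q \<le> snd p) zs"
      "\<And>p. p \<in> set zs \<Longrightarrow> s \<le> snd p" "\<And>p. p \<in> set zs \<Longrightarrow> snd p \<le> r" "s \<le> r" "r \<le> m"
    and sum: "\<And>\<omega>. step_sum W s xs \<omega> = step_sum W s zs \<omega> + d * (W m \<omega> - W r \<omega>)"
    and "fun": "\<And>u. step_fun s xs u = step_fun s zs u + d * indicator {r<..m} u"
  proof (cases ys)
    case Nil
    then show ?thesis
      using Suc.hyps(2) Suc.prems by (intro that[of "[]" s]) (auto simp: xs)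
  next
    case (Cons p ys')
    obtain d' m' where p: "p = (d', m')" by (cases p)
    \<comment> \<open>The value \<open>d\<close> on \<open>(s, m]\<close> is \<open>d\<close> on
      \<open>(s, m']\<close> plus \<open>d\<close> on \<open>(m', m]\<close>; the first piece is
      merged into the next pair.\<close>
    show ?thesis
    proof (rule that[of "(d + d', m') # ys'" m'])
      show "length ((d + d', m') # ys') = n"
        using Suc.hyps(2) by (simp add: xs Cons)
      show "s \<le> snd q" if "q \<in> set ((d + d', m') # ys')" for q
        using Suc.prems(2)[of q] Suc.prems(2)[of p] that by (auto simp: xs Cons p)
      show "sorted_wrt (\<lambda>p q. snd q \<le> snd p) ((d + d', m') # ys')" "m' \<le> m"
        using Suc.prems(1) by (auto simp: xs Cons p)
      show "snd q \<le> m'" if "q \<in> set ((d + d', m') # ys')" for q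
        using Suc.prems(1) that by (auto simp: xs Cons p)
      show "s \<le> m'"
        using Suc.prems(2)[of p] by (auto simp: xs Cons p)
      then show "step_fun s xs u = step_fun s ((d + d', m') # ys') u + d * indicator {m'<..m} u" for u
        using Suc.prems(1) by (auto simp: xs Cons p indicator_def algebra_simps)
    qed (simp add: xs Cons p algebra_simps)
  qed
  from Suc.hyps(1)[OF zs(1)[symmetric] zs(2,3)]
  have int: "integrable lborel (\<lambda>u. (step_fun s zs u)\<^sup>2)"
    and IH: "(\<integral>\<omega>. indicator A \<omega> * iexp (\<theta> * step_sum W s zs \<omega>) \<partial>M) =
      complex_of_real (prob A * exp (- (\<theta>\<^sup>2 * (\<integral>u. (step_fun s zs u)\<^sup>2 \<partial>lborel)) / 2))"
    by auto
  \<comment> \<open>The two parts have disjoint supports, so squaring produces no cross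
    term.\<close>
  have sq: "(step_fun s xs u)\<^sup>2 = (step_fun s zs u)\<^sup>2 + d\<^sup>2 * indicator {r<..m} u" for u
    using step_fun_eq_0[where xs=zs and r=r and u=u and s=s, OF zs(4)] by (auto simp: "fun" indicator_def)
  have int2: "integrable lborel (\<lambda>u. d\<^sup>2 * indicator {r<..m} u)"
    using zs(6) by (intro integrable_mult_right integrable_real_indicator) auto
  have exp_sum: "exp (- (a * (J + K)) / 2) = exp (- (a * J) / 2) * exp (- (a * K) / 2)" for a J K :: real
    by (simp add: field_simps flip: exp_add)
  have "(\<integral>u. (step_fun s xs u)\<^sup>2 \<partial>lborel) =
      (\<integral>u. (step_fun s zs u)\<^sup>2 \<partial>lborel) + d\<^sup>2 * (m - r)"
    unfolding sq Bochner_Integration.integral_add[OF int int2] using zs(6) by simp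
  moreover have "(\<integral>\<omega>. indicator A \<omega> * iexp (\<theta> * step_sum W s xs \<omega>) \<partial>M) =
      (\<integral>\<omega>. indicator A \<omega> * iexp (\<theta> * step_sum W s zs \<omega>) \<partial>M) * exp (- (\<theta>\<^sup>2 * (d\<^sup>2 * (m - r))) / 2)"
    unfolding sum
  proof (rule char_add_increment)
    show "step_sum W s zs \<in> borel_measurable (F r)"
      using assms(1) zs by (intro step_sum_measurable_F) auto
    show "A \<in> sets (F r)"
      using A sets_F_mono[OF zs(5)] by auto
  qed (use assms(1) zs in auto)
  ultimately have "(\<integral>\<omega>. indicator A \<omega> * iexp (\<theta> * step_sum W s xs \<omega>) \<partial>M) =
      complex_of_real (prob A * exp (- (\<theta>\<^sup>2 * (\<integral>u. (step_fun s xs u)\<^sup>2 \<partial>lborel)) / 2))"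
    by (simp only: IH exp_sum of_real_mult[of "prob A"] of_real_mult[of "exp a" for a] mult.assoc)
  moreover have "integrable lborel (\<lambda>u. (step_fun s xs u)\<^sup>2)"
    unfolding sq using int int2 by simp
  ultimately show ?case by simp
qed

lemma
  assumes "0 \<le> s" "\<And>p. p \<in> set xs \<Longrightarrow> s \<le> snd p"
  shows step_fun_integrable_power2: "integrable lborel (\<lambda>u. (step_fun s xs u)\<^sup>2)"
    and step_sum_char: "A \<in> sets (F s) \<Longrightarrow> (\<integral>\<omega>. indicator A \<omega> * iexp (\<theta> * step_sum W s xs \<omega>) \<partial>M) =
      complex_of_real (prob A * exp (- (\<theta>\<^sup>2 * (\<integral>u. (step_fun s xs u)\<^sup>2 \<partial>lborel)) / 2))"
proof -
  define ys where "ys = sort_key (\<lambda>p. - snd p) xs"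
  have "sorted (map (\<lambda>p. - snd p) ys)"
    unfolding ys_def by (rule sorted_sort_key)
  then have sorted: "sorted_wrt (\<lambda>p q. snd q \<le> snd p) ys"
    by (simp add: sorted_wrt_map)
  have mset: "mset xs = mset ys" and set: "set ys = set xs"
    by (simp_all add: ys_def)
  have ge: "\<And>p. p \<in> set ys \<Longrightarrow> s \<le> snd p"
    using assms(2) set by simp
  show "integrable lborel (\<lambda>u. (step_fun s xs u)\<^sup>2)"
    using step_sum_char_sorted[OF assms(1) sets.empty_sets sorted ge]
    unfolding step_fun_mset_cong[OF mset] by blast
  show "(\<integral>\<omega>. indicator A \<omega> * iexp (\<theta> * step_sum W s xs \<omega>) \<partial>M) =
      complex_of_real (prob A * exp (- (\<theta>\<^sup>2 * (\<integral>u. (step_fun s xs u)\<^sup>2 \<partial>lborel)) / 2))"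
    if "A \<in> sets (F s)"
    using step_sum_char_sorted[OF assms(1) that sorted ge]
    unfolding step_fun_mset_cong[OF mset] step_sum_mset_cong[OF mset] by blast
qed

end

section \<open>Mean-square limits of step sums and the Ito isometry\<close>

context brownian_motion
begin

text \<open>In contrast to \<open>has_ito_integral\<close> the approximants are deterministic, which
  makes the limit Gaussian. Integrands live on the whole line, so that integrals up to different
  times can be added.\<close>

definition wiener_integral :: "real \<Rightarrow> (real \<Rightarrow> real) \<Rightarrow> ('a \<Rightarrow> real) \<Rightarrow> bool" where
  "wiener_integral s f Y \<longleftrightarrow> f \<in> borel_measurable borel \<and> integrable lborel (\<lambda>u. (f u)\<^sup>2) \<and>
     Y \<in> borel_measurable M \<and>
     (\<exists>xs. (\<forall>k. \<forall>p\<in>set (xs k). s \<le> snd p) \<and>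
        L2_tendsto lborel (\<lambda>k. step_fun s (xs k)) f \<and> L2_tendsto M (\<lambda>k. step_sum W s (xs k)) Y)"

lemma wiener_integral_zero: "wiener_integral s (\<lambda>_. 0) (\<lambda>_. 0)"
  unfolding wiener_integral_def
  by (auto simp: L2_tendsto_def intro!: exI[of _ "\<lambda>_. []"])

lemma wiener_integral_add:
  assumes "0 \<le> s" "wiener_integral s f Y" "wiener_integral s g Z"
  shows "wiener_integral s (\<lambda>u. f u + g u) (\<lambda>\<omega>. Y \<omega> + Z \<omega>)"
proof -
  obtain xs ys where xs: "\<And>k p. p \<in> set (xs k) \<Longrightarrow> s \<le> snd p"
      "L2_tendsto lborel (\<lambda>k. step_fun s (xs k)) f" "L2_tendsto M (\<lambda>k. step_sum W s (xs k)) Y"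
    and ys: "\<And>k p. p \<in> set (ys k) \<Longrightarrow> s \<le> snd p"
      "L2_tendsto lborel (\<lambda>k. step_fun s (ys k)) g" "L2_tendsto M (\<lambda>k. step_sum W s (ys k)) Z"
    using assms(2,3) unfolding wiener_integral_def by metis
  have [measurable]: "f \<in> borel_measurable borel" "g \<in> borel_measurable borel"
      "Y \<in> borel_measurable M" "Z \<in> borel_measurable M"
    and f: "integrable lborel (\<lambda>u. (f u)\<^sup>2)" and g: "integrable lborel (\<lambda>u. (g u)\<^sup>2)"
    using assms(2,3) by (simp_all add: wiener_integral_def)
  have [measurable]: "step_sum W s (xs k) \<in> borel_measurable M" "step_sum W s (ys k) \<in> borel_measurable M" for k
    using assms(1) xs(1) ys(1) by (auto intro: step_sum_measurable)
  show ?thesis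
    unfolding wiener_integral_def
  proof (intro conjI exI[of _ "\<lambda>k. xs k @ ys k"])
    show "integrable lborel (\<lambda>u. (f u + g u)\<^sup>2)"
    proof (rule Bochner_Integration.integrable_bound)
      show "integrable lborel (\<lambda>u. 2 * (f u)\<^sup>2 + 2 * (g u)\<^sup>2)"
        using f g by simp
      show "AE u in lborel. norm ((f u + g u)\<^sup>2) \<le> norm (2 * (f u)\<^sup>2 + 2 * (g u)\<^sup>2)"
        using power2_add_le by (intro AE_I2) simp
    qed measurable
    show "\<forall>k. \<forall>p\<in>set (xs k @ ys k). s \<le> snd p"
      using xs(1) ys(1) by auto
    have "step_fun s (xs k @ ys k) = (\<lambda>u. step_fun s (xs k) u + step_fun s (ys k) u)" for k
      by (simp add: fun_eq_iff)
    then show "L2_tendsto lborel (\<lambda>k. step_fun s (xs k @ ys k)) (\<lambda>u. f u + g u)"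
      using L2_tendsto_add[OF xs(2) ys(2)] by simp
    have "step_sum W s (xs k @ ys k) = (\<lambda>\<omega>. step_sum W s (xs k) \<omega> + step_sum W s (ys k) \<omega>)" for k
      by (simp add: fun_eq_iff)
    then show "L2_tendsto M (\<lambda>k. step_sum W s (xs k @ ys k)) (\<lambda>\<omega>. Y \<omega> + Z \<omega>)"
      using L2_tendsto_add[OF xs(3) ys(3)] by simp
  qed measurable
qed

lemma wiener_integral_cmult:
  assumes "0 \<le> s" "wiener_integral s f Y"
  shows "wiener_integral s (\<lambda>u. c * f u) (\<lambda>\<omega>. c * Y \<omega>)"
proof -
  obtain xs where xs: "\<And>k p. p \<in> set (xs k) \<Longrightarrow> s \<le> snd p"
      "L2_tendsto lborel (\<lambda>k. step_fun s (xs k)) f" "L2_tendsto M (\<lambda>k. step_sum W s (xs k)) Y"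
    using assms(2) unfolding wiener_integral_def by metis
  have [measurable]: "f \<in> borel_measurable borel" "Y \<in> borel_measurable M"
    and f: "integrable lborel (\<lambda>u. (f u)\<^sup>2)"
    using assms(2) by (simp_all add: wiener_integral_def)
  have [measurable]: "step_sum W s (xs k) \<in> borel_measurable M" for k
    using assms(1) xs(1) by (auto intro: step_sum_measurable)
  let ?xs = "\<lambda>k. map (\<lambda>(d, r). (c * d, r)) (xs k)"
  show ?thesis
    unfolding wiener_integral_def
  proof (intro conjI exI[of _ ?xs])
    show "integrable lborel (\<lambda>u. (c * f u)\<^sup>2)"
      using f by (simp add: power_mult_distrib)
    show "\<forall>k. \<forall>p\<in>set (?xs k). s \<le> snd p"
      using xs(1) by fastforce
    have "step_fun s (?xs k) = (\<lambda>u. c * step_fun s (xs k) u)" for k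
      by (simp add: fun_eq_iff step_fun_scale)
    then show "L2_tendsto lborel (\<lambda>k. step_fun s (?xs k)) (\<lambda>u. c * f u)"
      using L2_tendsto_cmult[OF xs(2)] by simp
    have "step_sum W s (?xs k) = (\<lambda>\<omega>. c * step_sum W s (xs k) \<omega>)" for k
      by (simp add: fun_eq_iff step_sum_scale)
    then show "L2_tendsto M (\<lambda>k. step_sum W s (?xs k)) (\<lambda>\<omega>. c * Y \<omega>)"
      using L2_tendsto_cmult[OF xs(3)] by simp
  qed measurable
qed

lemma wiener_integral_sum:
  assumes "0 \<le> s" "finite I" "\<And>i. i \<in> I \<Longrightarrow> wiener_integral s (f i) (Y i)"
  shows "wiener_integral s (\<lambda>u. \<Sum>i\<in>I. a i * f i u) (\<lambda>\<omega>. \<Sum>i\<in>I. a i * Y i \<omega>)"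
  using assms(2,3)
proof (induction I)
  case (insert i I)
  then have "wiener_integral s (\<lambda>u. a i * f i u + (\<Sum>i\<in>I. a i * f i u))
      (\<lambda>\<omega>. a i * Y i \<omega> + (\<Sum>i\<in>I. a i * Y i \<omega>))"
    using assms(1) by (intro wiener_integral_add wiener_integral_cmult) auto
  then show ?case
    using insert.hyps by simp
qed (simp add: wiener_integral_zero)

text \<open>Both sides of \<open>step_sum_char\<close> pass to the limit, the left by mean-square
  convergence of the sums, the right by convergence of the variances. For all \<open>A\<close> and
  \<open>\<theta>\<close> together it says that \<open>Y\<close> is centred Gaussian and independent
  of \<open>F s\<close>.\<close>

lemma wiener_integral_char:
  assumes "0 \<le> s" "wiener_integral s f Y" and A: "A \<in> sets (F s)"
  shows "(\<integral>\<omega>. indicator A \<omega> * iexp (\<theta> * Y \<omega>) \<partial>M) =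
    complex_of_real (prob A * exp (- (\<theta>\<^sup>2 * (\<integral>u. (f u)\<^sup>2 \<partial>lborel)) / 2))"
proof -
  obtain xs where xs: "\<And>k p. p \<in> set (xs k) \<Longrightarrow> s \<le> snd p"
      "L2_tendsto lborel (\<lambda>k. step_fun s (xs k)) f" "L2_tendsto M (\<lambda>k. step_sum W s (xs k)) Y"
    using assms(2) unfolding wiener_integral_def by metis
  have [measurable]: "f \<in> borel_measurable borel" "Y \<in> borel_measurable M"
    and f: "integrable lborel (\<lambda>u. (f u)\<^sup>2)"
    using assms(2) by (simp_all add: wiener_integral_def)
  have [measurable]: "step_sum W s (xs k) \<in> borel_measurable M" for k
    using assms(1) xs(1) by (auto intro: step_sum_measurable)
  have [measurable]: "A \<in> events" using A sets_F_subset by auto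
  have "(\<lambda>k. \<integral>\<omega>. indicator A \<omega> * iexp (\<theta> * step_sum W s (xs k) \<omega>) \<partial>M)
      \<longlonglongrightarrow> (\<integral>\<omega>. indicator A \<omega> * iexp (\<theta> * Y \<omega>) \<partial>M)"
    by (rule L2_tendsto_iexp[OF xs(3)]) measurable
  moreover have "(\<integral>\<omega>. indicator A \<omega> * iexp (\<theta> * step_sum W s (xs k) \<omega>) \<partial>M) =
      complex_of_real (prob A * exp (- (\<theta>\<^sup>2 * (\<integral>u. (step_fun s (xs k) u)\<^sup>2 \<partial>lborel)) / 2))" for k
    by (rule step_sum_char[OF assms(1) xs(1) A])
  moreover have "(\<lambda>k. complex_of_real (prob A * exp (- (\<theta>\<^sup>2 * (\<integral>u. (step_fun s (xs k) u)\<^sup>2 \<partial>lborel)) / 2)))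
      \<longlonglongrightarrow> complex_of_real (prob A * exp (- (\<theta>\<^sup>2 * (\<integral>u. (f u)\<^sup>2 \<partial>lborel)) / 2))"
  proof -
    have "(\<lambda>k. \<integral>u. (step_fun s (xs k) u)\<^sup>2 \<partial>lborel) \<longlonglongrightarrow> (\<integral>u. (f u)\<^sup>2 \<partial>lborel)"
      using step_fun_integrable_power2[OF assms(1) xs(1)]
      by (intro L2_tendsto_integral_power2[OF xs(2)] f) auto
    then show ?thesis
      by (intro tendsto_intros) auto
  qed
  ultimately show ?thesis
    by (metis (no_types, lifting) LIMSEQ_unique ext)
qed

text \<open>Measurability and isometry share one induction: the partial sum must be known at time
  \<open>p n\<close> for the next increment to be independent of it.\<close>

lemma
  assumes "0 \<le> p 0" and "\<And>i. i < n \<Longrightarrow> p i \<le> p (Suc i)"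
    and "\<And>i. i < n \<Longrightarrow> \<eta> i \<in> borel_measurable (F (p i))"
    and "\<And>i \<omega>. i < n \<Longrightarrow> \<omega> \<in> space M \<Longrightarrow> \<bar>\<eta> i \<omega>\<bar> \<le> C"
  shows simple_ito_measurable: "0 \<le> p n \<and> simple_ito_integral W n p \<eta> \<in> borel_measurable (F (p n))" (is "?A n")
    and simple_ito_isometry: "integrable M (\<lambda>\<omega>. (simple_ito_integral W n p \<eta> \<omega>)\<^sup>2) \<and>
      (\<integral>\<omega>. (simple_ito_integral W n p \<eta> \<omega>)\<^sup>2 \<partial>M) = (\<Sum>i<n. (\<integral>\<omega>. (\<eta> i \<omega>)\<^sup>2 \<partial>M) * (p (Suc i) - p i))" (is "?B n")
proof -
  have "?A n \<and> ?B n"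
    using assms
  proof (induction n)
    case (Suc n)
    let ?S = "simple_ito_integral W n p \<eta>"
    let ?D = "\<lambda>\<omega>. W (p (Suc n)) \<omega> - W (p n) \<omega>"
    have IH: "0 \<le> p n" "?S \<in> borel_measurable (F (p n))" "integrable M (\<lambda>\<omega>. (?S \<omega>)\<^sup>2)"
        "(\<integral>\<omega>. (?S \<omega>)\<^sup>2 \<partial>M) = (\<Sum>i<n. (\<integral>\<omega>. (\<eta> i \<omega>)\<^sup>2 \<partial>M) * (p (Suc i) - p i))"
      using Suc by auto
    have le: "p n \<le> p (Suc n)"
      using Suc.prems(2) by simp
    have \<eta>: "\<eta> n \<in> borel_measurable (F (p n))" and C: "\<And>\<omega>. \<omega> \<in> space M \<Longrightarrow> \<bar>\<eta> n \<omega>\<bar> \<le> C"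
      using Suc.prems(3,4) by auto
    have [measurable]: "\<eta> n \<in> borel_measurable M" "?S \<in> borel_measurable M"
        "W (p n) \<in> borel_measurable M" "W (p (Suc n)) \<in> borel_measurable M"
      using measurable_F[OF \<eta>] measurable_F[OF IH(2)] IH(1) le by (auto intro: W_measurable)
    have step: "simple_ito_integral W (Suc n) p \<eta> = (\<lambda>\<omega>. ?S \<omega> + \<eta> n \<omega> * ?D \<omega>)"
      by (simp add: fun_eq_iff simple_ito_integral_def)
    have "?A (Suc n)"
    proof
      show "0 \<le> p (Suc n)" using IH(1) le by simp
      have "?S \<in> borel_measurable (F (p (Suc n)))" "\<eta> n \<in> borel_measurable (F (p (Suc n)))"
          "W (p n) \<in> borel_measurable (F (p (Suc n)))" "W (p (Suc n)) \<in> borel_measurable (F (p (Suc n)))"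
        using IH(1,2) \<eta> le by (auto intro: measurable_F_mono W_measurable_F)
      then show "simple_ito_integral W (Suc n) p \<eta> \<in> borel_measurable (F (p (Suc n)))"
        unfolding step by (intro borel_measurable_add borel_measurable_times borel_measurable_diff)
    qed
    moreover have "?B (Suc n)"
    proof (cases "p n = p (Suc n)")
      case True
      then show ?thesis
        unfolding step using IH by simp
    next
      case False
      with le have less: "p n < p (Suc n)" by simp
      have S: "integrable M ?S"
        using IH(3) by (rule square_integrable_imp_integrable[rotated]) simp
      have bound: "integrable M (\<lambda>\<omega>. \<eta> n \<omega> * ?S \<omega>)"
      proof (rule Bochner_Integration.integrable_bound[OF integrable_mult_right[OF S, of C]])
        show "AE \<omega> in M. norm (\<eta> n \<omega> * ?S \<omega>) \<le> norm (C * ?S \<omega>)"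
        proof (rule AE_I2)
          fix \<omega> assume "\<omega> \<in> space M"
          then have "\<bar>\<eta> n \<omega>\<bar> \<le> \<bar>C\<bar>"
            using C[of \<omega>] by linarith
          then show "norm (\<eta> n \<omega> * ?S \<omega>) \<le> norm (C * ?S \<omega>)"
            by (simp add: abs_mult mult_right_mono)
        qed
      qed measurable
      have \<eta>2: "integrable M (\<lambda>\<omega>. (\<eta> n \<omega>)\<^sup>2)"
      proof (rule integrable_const_bound[where B="C\<^sup>2"])
        show "AE \<omega> in M. norm ((\<eta> n \<omega>)\<^sup>2) \<le> C\<^sup>2"
          using C power_mono[of "\<bar>\<eta> n _\<bar>" C 2] by (intro AE_I2) simp
      qed measurable
      \<comment> \<open>The first independence makes the cross term vanish, as the increment has
        mean zero; the second gives the new summand of the isometry.\<close>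
      have ind1: "indep_var borel (\<lambda>\<omega>. \<eta> n \<omega> * ?S \<omega>) borel (\<lambda>\<omega>. ?D \<omega>)"
        by (rule increment_indep_var[OF IH(1) less borel_measurable_times[OF \<eta> IH(2)] measurable_ident[unfolded id_def]])
      have ind2: "indep_var borel (\<lambda>\<omega>. (\<eta> n \<omega>)\<^sup>2) borel (\<lambda>\<omega>. (?D \<omega>)\<^sup>2)"
        by (rule increment_indep_var[OF IH(1) less borel_measurable_power[OF \<eta>]
              borel_measurable_power[OF measurable_ident[unfolded id_def]]])
      note D = increment_integrable[OF IH(1) less] and D2 = increment_integrable_power2[OF IH(1) less]
      have cross: "integrable M (\<lambda>\<omega>. \<eta> n \<omega> * ?S \<omega> * ?D \<omega>)" "(\<integral>\<omega>. \<eta> n \<omega> * ?S \<omega> * ?D \<omega> \<partial>M) = 0"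
        using indep_var_integrable[OF ind1 bound D] indep_var_lebesgue_integral[OF ind1 bound D]
          increment_expectation[OF IH(1) less] by simp_all
      have sq: "integrable M (\<lambda>\<omega>. (\<eta> n \<omega>)\<^sup>2 * (?D \<omega>)\<^sup>2)"
          "(\<integral>\<omega>. (\<eta> n \<omega>)\<^sup>2 * (?D \<omega>)\<^sup>2 \<partial>M) = (\<integral>\<omega>. (\<eta> n \<omega>)\<^sup>2 \<partial>M) * (p (Suc n) - p n)"
        using indep_var_integrable[OF ind2 \<eta>2 D2] indep_var_lebesgue_integral[OF ind2 \<eta>2 D2]
          increment_variance[OF IH(1) less] by simp_all
      have eq: "(?S \<omega> + \<eta> n \<omega> * ?D \<omega>)\<^sup>2 = (?S \<omega>)\<^sup>2 + 2 * (\<eta> n \<omega> * ?S \<omega> * ?D \<omega>) + (\<eta> n \<omega>)\<^sup>2 * (?D \<omega>)\<^sup>2" for \<omega>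
        by (simp add: power2_eq_square algebra_simps)
      show ?thesis
        unfolding step eq using IH(3,4) cross sq by simp
    qed
    ultimately show ?case by blast
  qed (simp add: simple_ito_integral_def[abs_def])
  then show "?A n" "?B n" by blast+
qed

end

section \<open>Replacing random simple integrands by deterministic ones\<close>

lemma partition_mono:
  fixes p :: "nat \<Rightarrow> real"
  assumes "\<forall>i<n. p i \<le> p (Suc i)" "i \<le> j" "j \<le> n"
  shows "p i \<le> p j"
  using assms(2,3)
proof (induction j rule: dec_induct)
  case (step j)
  then have "p i \<le> p j" "p j \<le> p (Suc j)"
    using assms(1) by auto
  then show ?case by simp
qed simp

text \<open>A time lies in at most one cell. The quantifier over \<open>a\<close> stands inside so
  that one cell serves for the values, their means and their variances.\<close>

lemma partition_sum_cases:
  fixes p :: "nat \<Rightarrow> real"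
  assumes "\<forall>i<n. p i \<le> p (Suc i)"
  shows "(\<exists>j<n. \<forall>a::nat \<Rightarrow> real. (\<Sum>i<n. a i * indicator {p i<..p (Suc i)} u) = a j) \<or>
    (\<forall>a::nat \<Rightarrow> real. (\<Sum>i<n. a i * indicator {p i<..p (Suc i)} u) = 0)"
proof (cases "\<exists>j<n. u \<in> {p j<..p (Suc j)}")
  case True
  then obtain j where j: "j < n" "u \<in> {p j<..p (Suc j)}" by blast
  have "(\<Sum>i<n. a i * indicator {p i<..p (Suc i)} u) = a j" for a :: "nat \<Rightarrow> real"
  proof -
    have "indicator {p i<..p (Suc i)} u = (if i = j then 1 else 0 :: real)" if "i < n" for i
    proof -
      have "p (Suc i) \<le> p j" if "i < j"
        using partition_mono[OF assms, of "Suc i" j] that j by auto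
      moreover have "p (Suc j) \<le> p i" if "j < i"
        using partition_mono[OF assms, of "Suc j" i] that \<open>i < n\<close> by auto
      ultimately show ?thesis
        using j by (cases i j rule: linorder_cases) (auto simp: indicator_def)
    qed
    then have "(\<Sum>i<n. a i * indicator {p i<..p (Suc i)} u) = (\<Sum>i<n. if i = j then a i else 0)"
      by (intro sum.cong) auto
    then show ?thesis using j by simp
  qed
  with j show ?thesis by blast
next
  case False
  then have "(\<Sum>i<n. a i * indicator {p i<..p (Suc i)} u) = 0" for a :: "nat \<Rightarrow> real"
    by (intro sum.neutral) (auto simp: indicator_def)
  then show ?thesis by blast
qed

text \<open>Variance plus squared bias: the cross term is a multiple of \<open>X\<close> minus its
  mean and integrates to zero.\<close>

lemma (in prob_space) nn_integral_power2_diff_const: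
  fixes X :: "'a \<Rightarrow> real"
  assumes [measurable]: "X \<in> borel_measurable M" and bound: "\<And>\<omega>. \<omega> \<in> space M \<Longrightarrow> \<bar>X \<omega>\<bar> \<le> C"
  shows "(\<integral>\<^sup>+\<omega>. ennreal ((X \<omega> - b)\<^sup>2) \<partial>M) =
    ennreal (\<integral>\<omega>. (X \<omega> - expectation X)\<^sup>2 \<partial>M) + ennreal ((expectation X - b)\<^sup>2)"
proof -
  let ?c = "expectation X"
  have X: "integrable M X"
    by (rule integrable_const_bound[where B=C]) (use bound in auto)
  have X2: "integrable M (\<lambda>\<omega>. (X \<omega>)\<^sup>2)"
  proof (rule integrable_const_bound[where B="C\<^sup>2"])
    show "AE \<omega> in M. norm ((X \<omega>)\<^sup>2) \<le> C\<^sup>2"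
      using bound power_mono[of "\<bar>X _\<bar>" C 2] by (intro AE_I2) simp
  qed measurable
  have int: "integrable M (\<lambda>\<omega>. (X \<omega> - a)\<^sup>2)" for a
    using X X2 by (simp add: power2_diff)
  have "(X \<omega> - b)\<^sup>2 = (X \<omega> - ?c)\<^sup>2 + (2 * (?c - b) * (X \<omega> - ?c) + (?c - b)\<^sup>2)" for \<omega>
    by (simp add: power2_eq_square algebra_simps)
  then have "(\<integral>\<omega>. (X \<omega> - b)\<^sup>2 \<partial>M) = (\<integral>\<omega>. (X \<omega> - ?c)\<^sup>2 + (2 * (?c - b) * (X \<omega> - ?c) + (?c - b)\<^sup>2) \<partial>M)"
    by simp
  also have "\<dots> = (\<integral>\<omega>. (X \<omega> - ?c)\<^sup>2 \<partial>M) + (?c - b)\<^sup>2"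
    using int X by (simp add: prob_space)
  finally show ?thesis
    by (simp add: nn_integral_eq_integral[OF int] ennreal_plus)
qed

context brownian_motion
begin

text \<open>A deterministic integrand is approximated at least as well by the expectations of the random
  values \<open>\<xi> i\<close>: the mean-square error splits into the error of the expectations and the variance of
  \<open>\<xi>\<close>, and the latter is the mean-square distance of the two integrals by the Ito isometry.\<close>

lemma simple_integrand_deterministic:
  assumes s: "0 \<le> s" and simple: "simple_integrand M F s v n p \<xi>"
    and [measurable]: "g \<in> borel_measurable borel" and g: "\<And>u. u \<notin> {s..v} \<Longrightarrow> g u = 0"
  defines "D \<equiv> \<integral>\<^sup>+\<omega>. (\<integral>\<^sup>+u\<in>{s..v}. ennreal ((simple_process n p \<xi> u \<omega> - g u)\<^sup>2) \<partial>lborel) \<partial>M"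
  shows "\<exists>xs. (\<forall>q\<in>set xs. s \<le> snd q) \<and>
    (\<integral>\<^sup>+u. ennreal ((step_fun s xs u - g u)\<^sup>2) \<partial>lborel) \<le> D \<and>
    (\<integral>\<^sup>+\<omega>. ennreal ((step_sum W s xs \<omega> - simple_ito_integral W n p \<xi> \<omega>)\<^sup>2) \<partial>M) \<le> D"
proof -
  obtain C where p: "p 0 = s" "p n = v" and mono: "\<forall>i<n. p i \<le> p (Suc i)"
    and \<xi>F: "\<And>i. i < n \<Longrightarrow> \<xi> i \<in> borel_measurable (F (p i))"
    and C: "\<And>i \<omega>. i < n \<Longrightarrow> \<omega> \<in> space M \<Longrightarrow> \<bar>\<xi> i \<omega>\<bar> \<le> C"
    using simple unfolding simple_integrand_def by metis
  have \<xi>M: "\<xi> i \<in> borel_measurable M" if "i < n" for i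
    using \<xi>F[OF that] by (rule measurable_F)
  have cell: "s \<le> p i" "p (Suc i) \<le> v" "p i \<le> p (Suc i)" if "i < n" for i
    using partition_mono[OF mono, of 0 i] partition_mono[OF mono, of "Suc i" n] mono that p by auto
  define c where "c i = expectation (\<xi> i)" for i
  define var where "var i = (\<integral>\<omega>. (\<xi> i \<omega> - c i)\<^sup>2 \<partial>M)" for i
  \<comment> \<open>The integrals of the means and of the random values differ by the simple Ito
    integral of these centred values.\<close>
  define \<eta> where "\<eta> i \<omega> = c i - \<xi> i \<omega>" for i \<omega>
  \<comment> \<open>The value \<open>c i\<close> on \<open>(p i, p (Suc i)]\<close> is written as a
    difference of two segments starting at \<open>s\<close>, the only shape that a pair
    encodes.\<close>
  define xs where "xs = concat (map (\<lambda>i. [(c i, p (Suc i)), (- c i, p i)]) [0..<n])"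
  define cfun where "cfun u = (\<Sum>i<n. c i * indicator {p i<..p (Suc i)} u)" for u
  define vfun where "vfun u = (\<Sum>i<n. var i * indicator {p i<..p (Suc i)} u)" for u
  have [measurable]: "cfun \<in> borel_measurable borel" "vfun \<in> borel_measurable borel"
    unfolding cfun_def[abs_def] vfun_def[abs_def] by measurable
  have var_nonneg: "0 \<le> var i" for i
    by (simp add: var_def)
  have vfun_nonneg: "0 \<le> vfun u" for u
    unfolding vfun_def by (intro sum_nonneg mult_nonneg_nonneg var_nonneg) simp
  have xs_ge: "s \<le> snd q" if "q \<in> set xs" for q
  proof -
    obtain i where "i < n" "q = (c i, p (Suc i)) \<or> q = (- c i, p i)"
      using \<open>q \<in> set xs\<close> by (auto simp: xs_def)
    then show ?thesis
      using cell[of i] by auto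
  qed
  have step_fun_xs: "step_fun s xs u = cfun u" for u
  proof -
    have "step_fun s xs u = (\<Sum>i<n. step_fun s [(c i, p (Suc i)), (- c i, p i)] u)"
      unfolding xs_def step_fun_concat by (simp add: interv_sum_list_conv_sum_set_nat lessThan_atLeast0)
    also have "\<dots> = cfun u"
      unfolding cfun_def
    proof (intro sum.cong refl)
      fix i assume "i \<in> {..<n}"
      then show "step_fun s [(c i, p (Suc i)), (- c i, p i)] u = c i * indicator {p i<..p (Suc i)} u"
        using cell[of i] by (auto simp: indicator_def)
    qed
    finally show ?thesis .
  qed
  have step_sum_xs: "step_sum W s xs \<omega> - simple_ito_integral W n p \<xi> \<omega> = simple_ito_integral W n p \<eta> \<omega>" for \<omega>
  proof -
    have "step_sum W s xs \<omega> = (\<Sum>i<n. step_sum W s [(c i, p (Suc i)), (- c i, p i)] \<omega>)"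
      unfolding xs_def step_sum_concat by (simp add: interv_sum_list_conv_sum_set_nat lessThan_atLeast0)
    also have "\<dots> = (\<Sum>i<n. c i * (W (p (Suc i)) \<omega> - W (p i) \<omega>))"
      by (intro sum.cong) (auto simp: algebra_simps)
    finally show ?thesis
      by (simp add: simple_ito_integral_def \<eta>_def left_diff_distrib sum_subtractf)
  qed
  have pointwise: "(\<integral>\<^sup>+\<omega>. ennreal ((simple_process n p \<xi> u \<omega> - b)\<^sup>2) \<partial>M) =
      ennreal (vfun u) + ennreal ((cfun u - b)\<^sup>2)" for u b
    using partition_sum_cases[OF mono, of u]
  proof
    assume "\<exists>j<n. \<forall>a::nat \<Rightarrow> real. (\<Sum>i<n. a i * indicator {p i<..p (Suc i)} u) = a j"
    then obtain j where "j < n" and j: "\<And>a::nat \<Rightarrow> real. (\<Sum>i<n. a i * indicator {p i<..p (Suc i)} u) = a j"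
      by metis
    have "simple_process n p \<xi> u \<omega> = \<xi> j \<omega>" for \<omega>
      unfolding simple_process_def by (rule j)
    moreover have "vfun u = var j" "cfun u = c j"
      unfolding vfun_def cfun_def by (rule j)+
    ultimately show ?thesis
      using nn_integral_power2_diff_const[OF \<xi>M C, of j b] \<open>j < n\<close> by (simp add: var_def c_def)
  next
    assume 0: "\<forall>a::nat \<Rightarrow> real. (\<Sum>i<n. a i * indicator {p i<..p (Suc i)} u) = 0"
    have "simple_process n p \<xi> u \<omega> = 0" for \<omega>
      unfolding simple_process_def by (rule 0[rule_format])
    moreover have "vfun u = 0" "cfun u = 0"
      unfolding vfun_def cfun_def by (rule 0[rule_format])+
    ultimately show ?thesis
      by (simp add: emeasure_space_1)
  qed
  have outside: "cfun u = 0" "vfun u = 0" if "u \<notin> {s..v}" for u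
    unfolding cfun_def vfun_def using that cell by (force intro!: sum.neutral simp: indicator_def)+
  interpret P: pair_sigma_finite lborel M
    by unfold_locales
  \<comment> \<open>Tonelli moves the expectation inside, where \<open>pointwise\<close> splits it
    at each time.\<close>
  have "D = (\<integral>\<^sup>+u. (\<integral>\<^sup>+\<omega>. ennreal ((simple_process n p \<xi> u \<omega> - g u)\<^sup>2) * indicator {s..v} u \<partial>M) \<partial>lborel)"
    unfolding D_def
  proof (rule P.Fubini')
    have [measurable]: "(\<lambda>x. \<xi> i (snd x)) \<in> borel_measurable (lborel \<Otimes>\<^sub>M M)" if "i \<in> {..<n}" for i
      using measurable_compose[OF measurable_snd \<xi>M, of i] that by simp
    have [measurable]: "(\<lambda>x. simple_process n p \<xi> (fst x) (snd x)) \<in> borel_measurable (lborel \<Otimes>\<^sub>M M)"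
      unfolding simple_process_def by (intro borel_measurable_sum borel_measurable_times) measurable
    show "(\<lambda>(u, \<omega>). ennreal ((simple_process n p \<xi> u \<omega> - g u)\<^sup>2) * indicator {s..v} u) \<in> borel_measurable (lborel \<Otimes>\<^sub>M M)"
      unfolding case_prod_beta by measurable
  qed
  also have "\<dots> = (\<integral>\<^sup>+u. ennreal (vfun u) + ennreal ((cfun u - g u)\<^sup>2) \<partial>lborel)"
  proof (intro nn_integral_cong)
    fix u
    show "(\<integral>\<^sup>+\<omega>. ennreal ((simple_process n p \<xi> u \<omega> - g u)\<^sup>2) * indicator {s..v} u \<partial>M) =
        ennreal (vfun u) + ennreal ((cfun u - g u)\<^sup>2)"
      by (cases "u \<in> {s..v}") (simp_all add: pointwise outside g)
  qed
  also have "\<dots> = (\<integral>\<^sup>+u. ennreal (vfun u) \<partial>lborel) + (\<integral>\<^sup>+u. ennreal ((cfun u - g u)\<^sup>2) \<partial>lborel)"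
    by (intro nn_integral_add) measurable
  \<comment> \<open>Each summand is at most \<open>D\<close>. The second is the error of the means;
    the first is shown next to be the mean-square distance of the two integrals.\<close>
  finally have D: "D = \<dots>" .
  have "(\<integral>\<^sup>+u. ennreal (vfun u) \<partial>lborel) = (\<integral>\<^sup>+\<omega>. ennreal ((simple_ito_integral W n p \<eta> \<omega>)\<^sup>2) \<partial>M)"
  proof -
    have "emeasure lborel {p i<..p (Suc i)} < \<infinity>" for i
      by (cases "p i \<le> p (Suc i)") auto
    then have int: "integrable lborel (\<lambda>u. var i * indicator {p i<..p (Suc i)} u)" for i
      by (intro integrable_mult_right integrable_real_indicator) auto
    have "(\<integral>\<^sup>+u. ennreal (vfun u) \<partial>lborel) = ennreal (\<integral>u. vfun u \<partial>lborel)"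
      using vfun_nonneg int unfolding vfun_def
      by (intro nn_integral_eq_integral Bochner_Integration.integrable_sum) auto
    also have "(\<integral>u. vfun u \<partial>lborel) = (\<Sum>i<n. var i * (p (Suc i) - p i))"
      unfolding vfun_def by (subst Bochner_Integration.integral_sum[OF int]) (use cell in \<open>auto intro!: sum.cong\<close>)
    also have "\<dots> = (\<Sum>i<n. (\<integral>\<omega>. (\<eta> i \<omega>)\<^sup>2 \<partial>M) * (p (Suc i) - p i))"
      by (simp add: var_def \<eta>_def power2_commute)
    also have "ennreal \<dots> = (\<integral>\<^sup>+\<omega>. ennreal ((simple_ito_integral W n p \<eta> \<omega>)\<^sup>2) \<partial>M)"
    proof -
      have "integrable M (\<lambda>\<omega>. (simple_ito_integral W n p \<eta> \<omega>)\<^sup>2) \<and>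
          (\<integral>\<omega>. (simple_ito_integral W n p \<eta> \<omega>)\<^sup>2 \<partial>M) = (\<Sum>i<n. (\<integral>\<omega>. (\<eta> i \<omega>)\<^sup>2 \<partial>M) * (p (Suc i) - p i))"
      proof (rule simple_ito_isometry)
        show "0 \<le> p 0" using s p by simp
        show "p i \<le> p (Suc i)" if "i < n" for i using mono that by simp
        show "\<eta> i \<in> borel_measurable (F (p i))" if "i < n" for i
          unfolding \<eta>_def[abs_def] using \<xi>F[OF that] by (intro borel_measurable_diff) auto
        show "\<bar>\<eta> i \<omega>\<bar> \<le> (\<Sum>i<n. \<bar>c i\<bar>) + C" if "i < n" "\<omega> \<in> space M" for i \<omega>
        proof -
          have "\<bar>c i\<bar> \<le> (\<Sum>i<n. \<bar>c i\<bar>)"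
            using that by (intro member_le_sum) auto
          then show ?thesis
            using C[OF that] by (simp add: \<eta>_def)
        qed
      qed
      then show ?thesis
        by (simp add: nn_integral_eq_integral)
    qed
    finally show ?thesis .
  qed
  then show ?thesis
    using xs_ge by (intro exI[of _ xs]) (simp add: step_fun_xs step_sum_xs D)
qed

lemma wiener_integral_ito:
  assumes s: "0 \<le> s" and ito: "has_ito_integral M F W (\<lambda>u \<omega>. \<sigma> u) s v N"
    and \<sigma>[measurable]: "(\<lambda>u. indicator {s..v} u * \<sigma> u) \<in> borel_measurable borel"
  shows "wiener_integral s (\<lambda>u. indicator {s..v} u * \<sigma> u) N"
proof -
  let ?g = "\<lambda>u. indicator {s..v} u * \<sigma> u"
  obtain n p \<xi> where simple: "\<And>k. simple_integrand M F s v (n k) (p k) (\<xi> k)"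
    and lim1: "(\<lambda>k. \<integral>\<^sup>+\<omega>. (\<integral>\<^sup>+u\<in>{s..v}. ennreal ((simple_process (n k) (p k) (\<xi> k) u \<omega> - \<sigma> u)\<^sup>2) \<partial>lborel) \<partial>M) \<longlonglongrightarrow> 0"
    and lim2: "(\<lambda>k. \<integral>\<^sup>+\<omega>. ennreal ((simple_ito_integral W (n k) (p k) (\<xi> k) \<omega> - N \<omega>)\<^sup>2) \<partial>M) \<longlonglongrightarrow> 0"
    using ito unfolding has_ito_integral_def by blast
  have N[measurable]: "N \<in> borel_measurable M"
    and fin: "(\<integral>\<^sup>+\<omega>. (\<integral>\<^sup>+u\<in>{s..v}. ennreal ((\<sigma> u)\<^sup>2) \<partial>lborel) \<partial>M) < \<infinity>"
    using ito by (simp_all add: has_ito_integral_def)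
  \<comment> \<open>\<open>\<sigma>\<close> is replaced by its cut-off \<open>?g\<close>, which is
    Borel on the whole line and agrees with \<open>\<sigma>\<close> on
    \<open>{s..v}\<close>.\<close>
  define D where "D k = (\<integral>\<^sup>+\<omega>. (\<integral>\<^sup>+u\<in>{s..v}. ennreal ((simple_process (n k) (p k) (\<xi> k) u \<omega> - ?g u)\<^sup>2) \<partial>lborel) \<partial>M)" for k
  have "D = (\<lambda>k. \<integral>\<^sup>+\<omega>. (\<integral>\<^sup>+u\<in>{s..v}. ennreal ((simple_process (n k) (p k) (\<xi> k) u \<omega> - \<sigma> u)\<^sup>2) \<partial>lborel) \<partial>M)"
  proof
    show "D k = (\<integral>\<^sup>+\<omega>. (\<integral>\<^sup>+u\<in>{s..v}. ennreal ((simple_process (n k) (p k) (\<xi> k) u \<omega> - \<sigma> u)\<^sup>2) \<partial>lborel) \<partial>M)" for k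
      unfolding D_def by (intro nn_integral_cong) (auto simp: indicator_def)
  qed
  with lim1 have D: "D \<longlonglongrightarrow> 0"
    by (simp only:)
  define approx where "approx k xs \<longleftrightarrow> (\<forall>q\<in>set xs. s \<le> snd q) \<and>
      (\<integral>\<^sup>+u. ennreal ((step_fun s xs u - ?g u)\<^sup>2) \<partial>lborel) \<le> D k \<and>
      (\<integral>\<^sup>+\<omega>. ennreal ((step_sum W s xs \<omega> - simple_ito_integral W (n k) (p k) (\<xi> k) \<omega>)\<^sup>2) \<partial>M) \<le> D k" for k xs
  have "\<exists>xs. approx k xs" for k
    unfolding approx_def D_def by (rule simple_integrand_deterministic[OF s simple \<sigma>]) simp
  then obtain xs where approx: "\<And>k. approx k (xs k)"
    by metis
  have xs: "s \<le> snd q" if "q \<in> set (xs k)" for k q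
    using approx[of k] that unfolding approx_def by blast
  have xs1: "(\<integral>\<^sup>+u. ennreal ((step_fun s (xs k) u - ?g u)\<^sup>2) \<partial>lborel) \<le> D k"
    and xs2: "(\<integral>\<^sup>+\<omega>. ennreal ((step_sum W s (xs k) \<omega> - simple_ito_integral W (n k) (p k) (\<xi> k) \<omega>)\<^sup>2) \<partial>M) \<le> D k" for k
    using approx[of k] unfolding approx_def by simp_all
  have [measurable]: "step_sum W s (xs k) \<in> borel_measurable M" for k
    using s xs by (auto intro: step_sum_measurable)
  have [measurable]: "simple_ito_integral W (n k) (p k) (\<xi> k) \<in> borel_measurable M" for k
  proof -
    obtain C where "p k 0 = s" "\<forall>i<n k. p k i \<le> p k (Suc i)"
      "\<And>i. i < n k \<Longrightarrow> \<xi> k i \<in> borel_measurable (F (p k i))"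
      "\<And>i \<omega>. i < n k \<Longrightarrow> \<omega> \<in> space M \<Longrightarrow> \<bar>\<xi> k i \<omega>\<bar> \<le> C"
      using simple[of k] unfolding simple_integrand_def by metis
    then have "simple_ito_integral W (n k) (p k) (\<xi> k) \<in> borel_measurable (F (p k (n k)))"
      using s simple_ito_measurable[of "p k" "n k" "\<xi> k" C] by auto
    then show ?thesis
      by (rule measurable_F)
  qed
  show ?thesis
    unfolding wiener_integral_def
  proof (intro conjI exI[of _ xs])
    have "(\<integral>\<^sup>+u. ennreal ((?g u)\<^sup>2) \<partial>lborel) = (\<integral>\<^sup>+u\<in>{s..v}. ennreal ((\<sigma> u)\<^sup>2) \<partial>lborel)"
      by (intro nn_integral_cong) (simp add: indicator_def)
    \<comment> \<open>The integrand is deterministic, so the outer integral over a space of mass 1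
      drops out.\<close>
    also have "\<dots> < \<infinity>"
      using fin by (simp add: emeasure_space_1)
    finally show "integrable lborel (\<lambda>u. (?g u)\<^sup>2)"
      by (intro integrableI_nonneg) auto
    show "\<forall>k. \<forall>q\<in>set (xs k). s \<le> snd q"
      using xs by blast
    show "L2_tendsto lborel (\<lambda>k. step_fun s (xs k)) ?g"
      unfolding L2_tendsto_def
      by (rule tendsto_sandwich[OF _ _ tendsto_const D]) (auto intro!: always_eventually xs1)
    have "(\<lambda>k. \<integral>\<^sup>+\<omega>. ennreal ((step_sum W s (xs k) \<omega> - simple_ito_integral W (n k) (p k) (\<xi> k) \<omega>)\<^sup>2) \<partial>M) \<longlonglongrightarrow> 0"
      by (rule tendsto_sandwich[OF _ _ tendsto_const D]) (auto intro!: always_eventually xs2)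
    moreover have "L2_tendsto M (\<lambda>k. simple_ito_integral W (n k) (p k) (\<xi> k)) N"
      using lim2 by (simp add: L2_tendsto_def)
    ultimately show "L2_tendsto M (\<lambda>k. step_sum W s (xs k)) N"
      by (rule L2_tendsto_trans) measurable
  qed (rule \<sigma> N)+
qed

end

section \<open>The conditional law of the integrated process\<close>

text \<open>The noise at time \<open>u\<close> is weighted by the integral of h = - L' over
  \<open>[u, t]\<close>, that is, by L(u) - L(t) = L(u). The indicator form is the one that arises
  as a limit of grid sums.\<close>

lemma ou_L_eq_integral:
  assumes st: "s \<le> t" and \<beta>: "set_integrable lborel {s..t} \<beta>" and u: "u \<in> {s..t}"
  shows "(LINT v:{s..t}|lborel. (1 - \<beta> v * ou_L \<beta> t v) * indicator {u..} v) = ou_L \<beta> t u"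
proof -
  let ?h = "\<lambda>v. \<beta> v * ou_L \<beta> t v - 1"
  have L: "ac_on s t (ou_L \<beta> t) ?h"
    by (rule ac_on_ou_L[OF st \<beta>])
  have h: "set_integrable lborel {a..b} ?h" if "{a..b} \<subseteq> {s..t}" for a b
    using ac_on_integrable[OF L] by (rule set_integrable_subset) (use that in auto)
  have "(LINT v:{s..t}|lborel. (1 - \<beta> v * ou_L \<beta> t v) * indicator {u..} v) = (LINT v:{u..t}|lborel. - ?h v)"
    unfolding set_lebesgue_integral_def using u
    by (intro Bochner_Integration.integral_cong) (auto simp: indicator_def)
  also have "\<dots> = - (LINT v:{u..t}|lborel. ?h v)"
    by (rule set_integral_uminus[OF h]) (use u in auto)
  also have "\<dots> = (LINT v:{s..u}|lborel. ?h v) - (LINT v:{s..t}|lborel. ?h v)"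
    using set_integral_Icc_split[OF h[OF order_refl], of u] u by simp
  also have "\<dots> = (ou_L \<beta> t u - ou_L \<beta> t s) - (ou_L \<beta> t t - ou_L \<beta> t s)"
    using ac_on_eq[OF L, of u] ac_on_eq[OF L, of t] u st by simp
  also have "\<dots> = ou_L \<beta> t u"
    by (simp add: ou_L_self)
  finally show ?thesis .
qed

context brownian_motion
begin

text \<open>In the \<open>n\<close>-th sum \<sigma>(u) is multiplied by the total weight of the
  cells whose left endpoint is at least \<open>u\<close>, which tends to the integral of
  \<open>h\<close> beyond \<open>u\<close>.\<close>

lemma averaged_ito_char:
  assumes s: "0 \<le> s" and st: "s \<le> t" and h: "set_integrable lborel {s..t} h"
    and ito: "\<And>T. s \<le> T \<Longrightarrow> has_ito_integral M F W (\<lambda>u \<omega>. \<sigma> u) s T (N T)"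
    and \<sigma>[measurable]: "\<And>T. s \<le> T \<Longrightarrow> (\<lambda>u. indicator {s..T} u * \<sigma> u) \<in> borel_measurable borel"
    and X[measurable]: "X \<in> borel_measurable M"
    and lim: "AE \<omega> in M. (\<lambda>n. \<Sum>i\<le>grid_index s n t. cell_integral s t h n i * N (grid_point s n i) \<omega>) \<longlonglongrightarrow> X \<omega>"
    and A: "A \<in> sets (F s)"
  shows "(\<integral>\<omega>. indicator A \<omega> * iexp (\<theta> * X \<omega>) \<partial>M) = complex_of_real (prob A *
    exp (- (\<theta>\<^sup>2 * (\<integral>u. (indicator {s..t} u * \<sigma> u * (LINT v:{s..t}|lborel. h v * indicator {u..} v))\<^sup>2 \<partial>lborel)) / 2))"
proof -
  define Y where "Y n \<omega> = (\<Sum>i\<le>grid_index s n t. cell_integral s t h n i * N (grid_point s n i) \<omega>)" for n \<omega>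
  define f where "f n u = (\<Sum>i\<le>grid_index s n t. cell_integral s t h n i * (indicator {s..grid_point s n i} u * \<sigma> u))" for n u
  define fl where "fl u = indicator {s..t} u * \<sigma> u * (LINT v:{s..t}|lborel. h v * indicator {u..} v)" for u
  have [measurable]: "A \<in> events" using A sets_F_subset by auto
  have wiener: "wiener_integral s (f n) (Y n)" for n
    unfolding f_def[abs_def] Y_def[abs_def]
    by (intro wiener_integral_sum s wiener_integral_ito ito \<sigma> grid_point_ge) simp
  have [measurable]: "Y n \<in> borel_measurable M" "f n \<in> borel_measurable borel" for n
    using wiener by (simp_all add: wiener_integral_def)
  \<comment> \<open>For a grid point \<open>q\<close>, the condition \<open>u \<le> q\<close> is
    read as an indicator in \<open>q\<close>; the cut-off at \<open>t\<close> may be added because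
    \<open>q \<le> t\<close>. This is the form that \<open>grid_sum_tendsto\<close> takes.\<close>
  have f_eq: "f n u = indicator {s..t} u * \<sigma> u *
      (\<Sum>i\<le>grid_index s n t. cell_integral s t h n i * indicator {u..} (grid_point s n i))" for n u
    unfolding f_def sum_distrib_left
  proof (intro sum.cong refl)
    fix i assume "i \<in> {..grid_index s n t}"
    then have "grid_point s n i \<le> t"
      using st by (intro grid_point_le) auto
    then show "cell_integral s t h n i * (indicator {s..grid_point s n i} u * \<sigma> u) =
        indicator {s..t} u * \<sigma> u * (cell_integral s t h n i * indicator {u..} (grid_point s n i))"
      by (auto simp: indicator_def)
  qed
  have f_lim: "(\<lambda>n. f n u) \<longlonglongrightarrow> fl u" for u
    unfolding f_eq fl_def
  proof (intro tendsto_mult tendsto_const grid_sum_tendsto[OF h, where B=1])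
    show "set_borel_measurable lborel {s..t} (\<lambda>v. h v * indicator {u..} v)"
    proof -
      have [measurable]: "(\<lambda>v. indicator {s..t} v *\<^sub>R h v) \<in> borel_measurable lborel"
        using h unfolding set_integrable_def by (rule borel_measurable_integrable)
      have "(\<lambda>v. (indicator {s..t} v *\<^sub>R h v) * indicator {u..} v) \<in> borel_measurable lborel"
        by (intro borel_measurable_times) measurable
      then show ?thesis
        by (simp add: set_borel_measurable_def mult.assoc)
    qed
    \<comment> \<open>Grid points approach \<open>v\<close> from below, so at \<open>v = u\<close>
      the indicators need not converge to 1; this one point is null.\<close>
    show "AE v in lborel. v \<in> {s..t} \<longrightarrow>
        (\<lambda>n. indicator {u..} (grid_point s n (grid_index s n v)) :: real) \<longlonglongrightarrow> indicator {u..} v"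
      using AE_lborel_singleton[of u]
    proof eventually_elim
      case (elim v)
      show ?case
      proof
        assume v: "v \<in> {s..t}"
        have "\<forall>\<^sub>F n in sequentially.
            indicator {u..} (grid_point s n (grid_index s n v)) = (indicator {u..} v :: real)"
        proof (cases "u < v")
          case True
          have "(\<lambda>n. grid_point s n (grid_index s n v)) \<longlonglongrightarrow> v"
            using v by (intro grid_point_tendsto) simp
          then have "\<forall>\<^sub>F n in sequentially. u < grid_point s n (grid_index s n v)"
            using True by (rule order_tendstoD)
          then show ?thesis
            by eventually_elim (use True in \<open>auto simp: indicator_def\<close>)
        next
          case False
          then have "v < u" using elim by auto
          then show ?thesis
            using grid_point_grid_index(1)[of s v] v
            by (intro always_eventually allI) (force simp: indicator_def not_le intro: le_less_trans)
        qed
        then show "(\<lambda>n. indicator {u..} (grid_point s n (grid_index s n v)) :: real) \<longlonglongrightarrow> indicator {u..} v"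
          by (rule tendsto_eventually)
      qed
    qed
  qed (simp add: indicator_def)
  have f_lim2: "(\<lambda>n. \<integral>u. (f n u)\<^sup>2 \<partial>lborel) \<longlonglongrightarrow> (\<integral>u. (fl u)\<^sup>2 \<partial>lborel)"
  proof (rule integral_dominated_convergence)
    \<comment> \<open>The factor of \<open>\<sigma>\<close> is bounded by \<open>?H\<close> for
      every \<open>n\<close>, and \<open>\<sigma>\<close> is square integrable on
      \<open>{s..t}\<close> because its Ito integral exists.\<close>
    let ?H = "LINT v:{s..t}|lborel. \<bar>h v\<bar>"
    have "wiener_integral s (\<lambda>u. indicator {s..t} u * \<sigma> u) (N t)"
      by (intro wiener_integral_ito s ito st \<sigma>)
    then show "integrable lborel (\<lambda>u. ?H\<^sup>2 * (indicator {s..t} u * \<sigma> u)\<^sup>2)"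
      by (intro integrable_mult_right) (simp add: wiener_integral_def)
    have "fl \<in> borel_measurable lborel"
      by (rule borel_measurable_LIMSEQ_real[OF f_lim]) simp
    then show "(\<lambda>u. (fl u)\<^sup>2) \<in> borel_measurable lborel"
      by (rule borel_measurable_power)
    show "(\<lambda>u. (f n u)\<^sup>2) \<in> borel_measurable lborel" for n
      by simp
    show "AE u in lborel. (\<lambda>n. (f n u)\<^sup>2) \<longlonglongrightarrow> (fl u)\<^sup>2"
      by (intro AE_I2 tendsto_power f_lim)
    show "AE u in lborel. norm ((f n u)\<^sup>2) \<le> ?H\<^sup>2 * (indicator {s..t} u * \<sigma> u)\<^sup>2" for n
    proof (rule AE_I2)
      fix u
      define c where "c = (\<Sum>i\<le>grid_index s n t. cell_integral s t h n i * (indicator {u..} (grid_point s n i) :: real))"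
      have "\<bar>c\<bar> \<le> 1 * ?H"
        unfolding c_def by (rule grid_sum_bound[OF h]) (simp add: indicator_def)
      then have "c\<^sup>2 \<le> ?H\<^sup>2"
        using power_mono[of "\<bar>c\<bar>" ?H 2] by simp
      then show "norm ((f n u)\<^sup>2) \<le> ?H\<^sup>2 * (indicator {s..t} u * \<sigma> u)\<^sup>2"
        unfolding f_eq c_def[symmetric]
        using mult_right_mono[of "c\<^sup>2" "?H\<^sup>2" "(indicator {s..t} u * \<sigma> u)\<^sup>2"]
        by (simp add: power_mult_distrib mult_ac)
    qed
  qed
  have "(\<lambda>n. \<integral>\<omega>. indicator A \<omega> * iexp (\<theta> * Y n \<omega>) \<partial>M) \<longlonglongrightarrow> (\<integral>\<omega>. indicator A \<omega> * iexp (\<theta> * X \<omega>) \<partial>M)"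
  proof (rule integral_dominated_convergence[where w="\<lambda>_. 1"])
    show "AE \<omega> in M. (\<lambda>n. indicator A \<omega> * iexp (\<theta> * Y n \<omega>)) \<longlonglongrightarrow> indicator A \<omega> * iexp (\<theta> * X \<omega>)"
      using lim unfolding Y_def[symmetric]
    proof eventually_elim
      case (elim \<omega>)
      then show ?case by (intro tendsto_intros)
    qed
    show "AE \<omega> in M. norm (indicator A \<omega> * iexp (\<theta> * Y n \<omega>)) \<le> 1" for n
      by (simp add: norm_mult indicator_def)
  qed auto
  moreover have "(\<integral>\<omega>. indicator A \<omega> * iexp (\<theta> * Y n \<omega>) \<partial>M) =
      complex_of_real (prob A * exp (- (\<theta>\<^sup>2 * (\<integral>u. (f n u)\<^sup>2 \<partial>lborel)) / 2))" for n
    by (rule wiener_integral_char[OF s wiener A])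
  moreover have "(\<lambda>n. complex_of_real (prob A * exp (- (\<theta>\<^sup>2 * (\<integral>u. (f n u)\<^sup>2 \<partial>lborel)) / 2))) \<longlonglongrightarrow>
      complex_of_real (prob A * exp (- (\<theta>\<^sup>2 * (\<integral>u. (fl u)\<^sup>2 \<partial>lborel)) / 2))"
    by (intro tendsto_intros f_lim2) auto
  ultimately show ?thesis
    unfolding fl_def by (metis (no_types, lifting) LIMSEQ_unique ext)
qed

text \<open>Joint measurability is given from time \<open>s\<close> on; freezing time at
  \<open>s\<close> before that extends \<open>y\<close> to the whole line and leaves the integral
  over \<open>{s..t}\<close> unchanged.\<close>

lemma integral_time_measurable:
  fixes y :: "real \<Rightarrow> 'a \<Rightarrow> real"
  assumes "(\<lambda>(u, \<omega>). y u \<omega>) \<in> borel_measurable (restrict_space borel {s..} \<Otimes>\<^sub>M M)"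
  shows "(\<lambda>\<omega>. LINT u:{s..t}|lborel. y u \<omega>) \<in> borel_measurable M"
proof -
  have [measurable]: "(\<lambda>u. max s u) \<in> borel \<rightarrow>\<^sub>M restrict_space borel {s..}"
    by (rule measurable_restrict_space2) auto
  have "(\<lambda>x. (max s (snd x), fst x)) \<in> M \<Otimes>\<^sub>M lborel \<rightarrow>\<^sub>M restrict_space borel {s..} \<Otimes>\<^sub>M M"
    by measurable
  from measurable_compose[OF this assms]
  have [measurable]: "(\<lambda>x. y (max s (snd x)) (fst x)) \<in> borel_measurable (M \<Otimes>\<^sub>M lborel)"
    by (simp add: case_prod_beta)
  have "(\<lambda>\<omega>. LINT u|lborel. indicator {s..t} u *\<^sub>R y (max s u) \<omega>) \<in> borel_measurable M"
    by (rule lborel.borel_measurable_lebesgue_integral) (unfold case_prod_beta, measurable)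
  moreover have "(LINT u|lborel. indicator {s..t} u *\<^sub>R y (max s u) \<omega>) = (LINT u:{s..t}|lborel. y u \<omega>)" for \<omega>
    unfolding set_lebesgue_integral_def
    by (intro Bochner_Integration.integral_cong) (auto simp: indicator_def max_def)
  ultimately show ?thesis
    by (simp only:)
qed

end

section \<open>The conditional Laplace transform\<close>

theorem corollary3p1:
  fixes Q :: "'a measure" and F :: "real \<Rightarrow> 'a measure" and W :: "real \<Rightarrow> 'a \<Rightarrow> real"
    and \<alpha> \<beta> \<sigma> :: "real \<Rightarrow> real" and lam :: "real \<Rightarrow> 'a \<Rightarrow> real" and s t x :: real
  assumes "brownian_motion Q F W"
    and "0 \<le> s"
    and "\<And>T. s \<le> T \<Longrightarrow> set_integrable lborel {s..T} \<alpha>"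
    and "\<And>T. s \<le> T \<Longrightarrow> set_integrable lborel {s..T} \<beta>"
    and "\<And>T. s \<le> T \<Longrightarrow> set_integrable lborel {s..T} \<sigma>"
    and "sde_solution Q F W (\<lambda>u y. \<alpha> u - \<beta> u * y) \<sigma> s lam"
    and "s \<le> t"
  shows "AE \<omega> in Q. cond_laplace Q (\<lambda>\<omega>. LBINT u=s..t. lam u \<omega>) (lam s) x \<omega> =
           ennreal (exp (- ou_M \<alpha> \<beta> s t (lam s \<omega>) * x + x\<^sup>2 * ou_V \<beta> \<sigma> s t / 2))"
proof -
  interpret brownian_motion Q F W by fact
  note s = \<open>0 \<le> s\<close> and st = \<open>s \<le> t\<close>
  have \<alpha>: "set_integrable lborel {s..t} \<alpha>" and \<beta>: "set_integrable lborel {s..t} \<beta>"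
    using assms(3,4) st by auto
  define b where "b u \<omega> = \<alpha> u - \<beta> u * lam u \<omega>" for u \<omega>
  have lam_s: "lam s \<in> borel_measurable (F s)"
    and lam_meas: "(\<lambda>(u, \<omega>). lam u \<omega>) \<in> borel_measurable (restrict_space borel {s..} \<Otimes>\<^sub>M Q)"
    and lam_cont: "AE \<omega> in Q. continuous_on {s..} (\<lambda>u. lam u \<omega>)"
    and b_int: "AE \<omega> in Q. set_integrable lborel {s..t} (\<lambda>u. b u \<omega>)"
    using assms(6) st unfolding sde_solution_def b_def by auto
  \<comment> \<open>Integral and equation are bundled so that one choice gives, for each
    \<open>T\<close>, a version \<open>N T\<close> with both properties.\<close>
  define noise where "noise T N \<longleftrightarrow> has_ito_integral Q F W (\<lambda>u \<omega>. \<sigma> u) s T N \<and>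
      (AE \<omega> in Q. lam T \<omega> = lam s \<omega> + (LBINT u=s..T. b u \<omega>) + N \<omega>)" for T N
  have "\<exists>N. noise T N" if "s \<le> T" for T
    using assms(6) that unfolding sde_solution_def noise_def b_def by simp
  then obtain N where noise: "\<And>T. s \<le> T \<Longrightarrow> noise T (N T)"
    by metis
  have ito: "has_ito_integral Q F W (\<lambda>u \<omega>. \<sigma> u) s T (N T)"
    and N: "AE \<omega> in Q. lam T \<omega> = lam s \<omega> + (LBINT u=s..T. b u \<omega>) + N T \<omega>" if "s \<le> T" for T
    using noise[OF that] by (simp_all add: noise_def)
  define h where "h u = 1 - \<beta> u * ou_L \<beta> t u" for u
  have h: "set_integrable lborel {s..t} h"
  proof -
    have "set_integrable lborel {s..t} (\<lambda>u. - 1 *\<^sub>R (\<beta> u * ou_L \<beta> t u - 1))"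
      using ac_on_integrable[OF ac_on_ou_L[OF st \<beta>]] by (intro set_integrable_scaleR_right)
    then show ?thesis
      by (simp add: h_def[abs_def])
  qed
  define Lam where "Lam \<omega> = (LINT u:{s..t}|lborel. lam u \<omega>)" for \<omega>
  \<comment> \<open>\<open>X\<close> turns out to be the integral of h Z almost surely; this
    definition makes it measurable without reference to \<open>Z\<close>, which is built path by
    path.\<close>
  define X where "X \<omega> = Lam \<omega> - ou_M \<alpha> \<beta> s t (lam s \<omega>)" for \<omega>
  have [measurable]: "lam s \<in> borel_measurable Q"
    using lam_s by (rule measurable_F)
  \<comment> \<open>By \<open>ou_M_eq\<close> the mean is affine in the initial value.\<close>
  have ou_M_meas[measurable]: "ou_M \<alpha> \<beta> s t \<in> borel_measurable borel"
    unfolding ou_M_eq[OF st \<beta> \<alpha>, abs_def] by measurable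
  have [measurable]: "Lam \<in> borel_measurable Q"
    unfolding Lam_def[abs_def] by (rule integral_time_measurable[OF lam_meas])
  have [measurable]: "X \<in> borel_measurable Q"
    unfolding X_def[abs_def] by measurable
  \<comment> \<open>The exceptional set of the equation depends on the time; the grid points are
    countable, so one null set remains.\<close>
  have "AE \<omega> in Q. \<forall>n i. lam (grid_point s n i) \<omega> =
      lam s \<omega> + (LBINT u=s..grid_point s n i. b u \<omega>) + N (grid_point s n i) \<omega>"
    unfolding AE_all_countable by (intro allI N grid_point_ge)
  then have "AE \<omega> in Q. (\<lambda>n. \<Sum>i\<le>grid_index s n t. cell_integral s t h n i * N (grid_point s n i) \<omega>) \<longlonglongrightarrow> X \<omega>"
    using lam_cont b_int
  proof eventually_elim
    case (elim \<omega>)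
    \<comment> \<open>\<open>Z\<close> is continuous and agrees with the chosen versions at the grid
      points, which is all that the sums see.\<close>
    define Z where "Z u = lam u \<omega> - lam s \<omega> - (LINT v:{s..u}|lborel. b v \<omega>)" for u
    have cont: "continuous_on {s..t} (\<lambda>u. lam u \<omega>)"
      using elim(2) by (rule continuous_on_subset) auto
    have "continuous_on {s..t} (\<lambda>u. lam s \<omega> + (LINT v:{s..u}|lborel. b v \<omega>))"
      by (rule ac_on_continuous[OF ac_on_indefinite_integral[OF elim(3)]])
    with cont have "continuous_on {s..t} (\<lambda>u. lam u \<omega> - (lam s \<omega> + (LINT v:{s..u}|lborel. b v \<omega>)))"
      by (rule continuous_on_diff)
    then have Z_cont: "continuous_on {s..t} Z"
      by (simp add: Z_def[abs_def] diff_diff_eq)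
    have "Lam \<omega> = ou_L \<beta> t s * lam s \<omega> + (LINT u:{s..t}|lborel. \<alpha> u * ou_L \<beta> t u) +
        (LINT u:{s..t}|lborel. (1 - \<beta> u * ou_L \<beta> t u) * Z u)"
      unfolding Lam_def by (rule linear_ode_integral[OF st \<beta> \<alpha> cont]) (simp add: Z_def b_def)
    then have X: "X \<omega> = (LINT u:{s..t}|lborel. h u * Z u)"
      by (simp add: X_def ou_M_eq[OF st \<beta> \<alpha>] h_def)
    have NZ: "N (grid_point s n i) \<omega> = Z (grid_point s n i)" for n i
      using elim(1)[rule_format, of n i] grid_point_ge[of s n i]
      by (simp add: Z_def interval_integral_Icc)
    obtain B where B: "\<And>u. u \<in> {s..t} \<Longrightarrow> \<bar>Z u\<bar> \<le> B"
      using continuous_on_Icc_bounded[OF Z_cont] by metis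
    show ?case
      unfolding NZ X
    proof (rule grid_sum_tendsto[OF h])
      show "\<bar>Z r\<bar> \<le> B" if "s \<le> r" "r \<le> t" for r
        using B that by simp
      have "set_integrable lborel {s..t} (\<lambda>v. h v * Z v)"
        using set_integrable_mult_continuous[OF h Z_cont] by (simp add: mult.commute)
      then show "set_borel_measurable lborel {s..t} (\<lambda>v. h v * Z v)"
        unfolding set_integrable_def set_borel_measurable_def by (rule borel_measurable_integrable)
      show "AE v in lborel. v \<in> {s..t} \<longrightarrow> (\<lambda>n. Z (grid_point s n (grid_index s n v))) \<longlonglongrightarrow> Z v"
      proof (intro AE_I2 impI)
        fix v assume v: "v \<in> {s..t}"
        have "grid_point s n (grid_index s n v) \<in> {s..t}" for n
          using v grid_point_ge[of s n] grid_point_grid_index(1)[of s v n] by auto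
        then show "(\<lambda>n. Z (grid_point s n (grid_index s n v))) \<longlonglongrightarrow> Z v"
          using v by (intro continuous_on_tendsto_compose[OF Z_cont grid_point_tendsto]) auto
      qed
    qed
  qed
  note X_lim = this
  define V where "V = ou_V \<beta> \<sigma> s t"
  have V: "(\<integral>u. (indicator {s..t} u * \<sigma> u * (LINT v:{s..t}|lborel. h v * indicator {u..} v))\<^sup>2 \<partial>lborel) = V"
  proof -
    have "V = (LINT u:{s..t}|lborel. (\<sigma> u * ou_L \<beta> t u)\<^sup>2)"
      using st by (simp add: V_def ou_V_def ou_K_eq interval_integral_Icc)
    also have "\<dots> = (\<integral>u. (indicator {s..t} u * \<sigma> u * (LINT v:{s..t}|lborel. h v * indicator {u..} v))\<^sup>2 \<partial>lborel)"
      unfolding set_lebesgue_integral_def[of lborel "{s..t}" "\<lambda>u. (\<sigma> u * ou_L \<beta> t u)\<^sup>2"]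
    proof (intro Bochner_Integration.integral_cong refl)
      fix u
      show "indicator {s..t} u *\<^sub>R (\<sigma> u * ou_L \<beta> t u)\<^sup>2 =
          (indicator {s..t} u * \<sigma> u * (LINT v:{s..t}|lborel. h v * indicator {u..} v))\<^sup>2"
        by (cases "u \<in> {s..t}") (simp_all add: h_def ou_L_eq_integral[OF st \<beta>])
    qed
    finally show ?thesis ..
  qed
  have "0 \<le> V"
    unfolding V[symmetric] by (rule Bochner_Integration.integral_nonneg) simp
  have \<sigma>: "(\<lambda>u. indicator {s..T} u * \<sigma> u) \<in> borel_measurable borel" if "s \<le> T" for T
    using borel_measurable_integrable[OF assms(5)[OF that, unfolded set_integrable_def]] by simp
  have X_moment: "(\<integral>\<^sup>+\<omega>\<in>A. ennreal (exp (- x * X \<omega>)) \<partial>Q) = ennreal (exp (x\<^sup>2 * V / 2)) * emeasure Q A"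
    if A: "A \<in> sets (F s)" for A
  proof -
    have "(\<integral>\<^sup>+\<omega>\<in>A. ennreal (exp (- x * X \<omega>)) \<partial>Q) = ennreal (exp ((- x)\<^sup>2 * V / 2)) * emeasure Q A"
    proof (rule gaussian_exp_moment_on)
      show "A \<in> events" using A sets_F_subset by auto
      show "(\<integral>\<omega>. indicator A \<omega> * iexp (\<theta> * X \<omega>) \<partial>Q) =
          complex_of_real (prob A * exp (- (\<theta>\<^sup>2 * V) / 2))" for \<theta>
        using averaged_ito_char[OF s st h ito \<sigma> _ X_lim A, of \<theta>] unfolding V by simp
    qed (simp_all add: \<open>0 \<le> V\<close>)
    then show ?thesis by simp
  qed
  \<comment> \<open>The conditioning sigma-algebra lies inside \<open>F s\<close>, so
    \<open>X_moment\<close> applies to each of its sets.\<close>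
  define G where "G = vimage_algebra (space Q) (lam s) borel"
  have lam_G: "lam s \<in> borel_measurable G"
    unfolding G_def by (rule measurable_vimage_algebra1) simp
  have sets_G: "sets G \<subseteq> sets (F s)"
    unfolding G_def by (subst sets_vimage_algebra2) (use measurable_sets[OF lam_s] in \<open>auto simp: space_F\<close>)
  have G: "subalgebra Q G"
    unfolding subalgebra_def using sets_G sets_F_subset[of s] by (auto simp: G_def)
  interpret G: finite_measure_subalgebra Q G
    by unfold_locales (rule G)
  \<comment> \<open>By \<open>X_moment\<close> the integral over a set is a constant times its
    measure, so the conditional expectation is that constant.\<close>
  have X_cond: "AE \<omega> in Q. ennreal (exp (x\<^sup>2 * V / 2)) = nn_cond_exp Q G (\<lambda>\<omega>. ennreal (exp (- x * X \<omega>))) \<omega>"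
  proof (rule G.nn_cond_exp_charact)
    fix A assume A: "A \<in> sets G"
    then have AF: "A \<in> sets (F s)" and "A \<in> events"
      using sets_G sets_F_subset by auto
    then show "(\<integral>\<^sup>+\<omega>\<in>A. ennreal (exp (- x * X \<omega>)) \<partial>Q) = (\<integral>\<^sup>+\<omega>\<in>A. ennreal (exp (x\<^sup>2 * V / 2)) \<partial>Q)"
      unfolding X_moment[OF AF] by (simp add: nn_integral_cmult_indicator)
  qed measurable
  \<comment> \<open>The mean is a measurable function of \<open>lam s\<close>, so its exponential
    can be taken out. Values lie in \<open>[0, \<infinity>]\<close>, as this exponential may have
    infinite expectation.\<close>
  have prod_cond: "AE \<omega> in Q. ennreal (exp (- x * ou_M \<alpha> \<beta> s t (lam s \<omega>))) *
      nn_cond_exp Q G (\<lambda>\<omega>. ennreal (exp (- x * X \<omega>))) \<omega> =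
      nn_cond_exp Q G (\<lambda>\<omega>. ennreal (exp (- x * ou_M \<alpha> \<beta> s t (lam s \<omega>))) * ennreal (exp (- x * X \<omega>))) \<omega>"
  proof (rule G.nn_cond_exp_prod)
    have "(\<lambda>\<omega>. ou_M \<alpha> \<beta> s t (lam s \<omega>)) \<in> borel_measurable G"
      by (rule measurable_compose[OF lam_G ou_M_meas])
    then show "(\<lambda>\<omega>. ennreal (exp (- x * ou_M \<alpha> \<beta> s t (lam s \<omega>)))) \<in> borel_measurable G"
      by simp
  qed measurable
  have prod_eq: "(\<lambda>\<omega>. ennreal (exp (- x * ou_M \<alpha> \<beta> s t (lam s \<omega>))) * ennreal (exp (- x * X \<omega>))) =
      (\<lambda>\<omega>. ennreal (exp (- x * (LBINT u=s..t. lam u \<omega>))))"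
  proof
    fix \<omega>
    have "(LBINT u=s..t. lam u \<omega>) = ou_M \<alpha> \<beta> s t (lam s \<omega>) + X \<omega>"
      using st by (simp add: X_def Lam_def interval_integral_Icc)
    then show "ennreal (exp (- x * ou_M \<alpha> \<beta> s t (lam s \<omega>))) * ennreal (exp (- x * X \<omega>)) =
        ennreal (exp (- x * (LBINT u=s..t. lam u \<omega>)))"
      by (simp add: distrib_left exp_diff exp_minus exp_add ennreal_mult[symmetric] field_simps)
  qed
  have "AE \<omega> in Q. nn_cond_exp Q G (\<lambda>\<omega>. ennreal (exp (- x * (LBINT u=s..t. lam u \<omega>)))) \<omega> =
      ennreal (exp (- x * ou_M \<alpha> \<beta> s t (lam s \<omega>))) * ennreal (exp (x\<^sup>2 * V / 2))"
    using X_cond prod_cond[unfolded prod_eq]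
  proof eventually_elim
    case (elim \<omega>)
    show ?case
      by (simp only: elim(1) elim(2)[symmetric])
  qed
  then show ?thesis
    unfolding cond_laplace_def G_def[symmetric] V_def[symmetric]
  proof eventually_elim
    case (elim \<omega>)
    have "exp (- x * ou_M \<alpha> \<beta> s t (lam s \<omega>)) * exp (x\<^sup>2 * V / 2) =
        exp (- ou_M \<alpha> \<beta> s t (lam s \<omega>) * x + x\<^sup>2 * V / 2)"
      by (simp add: mult.commute flip: exp_add)
    with elim show ?case
      by (simp add: ennreal_mult[symmetric] del: exp_add)
  qed
qed

end
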